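(* Let $k$ be a subfield of $\mathbb{C}$ (not necessarily algebraically closed), let $L=p_0\partial_x^n+\cdots+p_{n-1}\partial_x+p_n$ with $p_i\in k[x]$, $p_0\neq 0$, $n\ge 1$, be a Fuchsian differential operator with set of singularities $S=\{t_1,\dots,t_r,\infty\}$ ($t_1,\dots,t_r\in\bar k$ pairwise distinct), let $\Delta=\prod_{i=1}^r(x-t_i)\in k[x]$, and let $f$ be a solution of $L$, i.e. $Lf=0$. If $L$ has no integer exponent $\geq n$ at any finite point and no positive integer exponent at $\infty$, then the $k$-vector space $H^1_{\mathrm{dR}}(\mathbb{P}^1-S,L)$ is generated by the classes of $$\frac{x^jf^{(i)}\,dx}{\Delta},\qquad j=0,1,\dots,r-1,\quad i=0,1,\dots,n-1.$$
   Context: Here $\partial_x=d/dx$, $f^{(i)}=\partial_x^i f$, and $\bar k\subset\mathbb{C}$ is the algebraic closure of $k$. The finite singularities $t_1,\dots,t_r\in\bar k$ of $L$ are the poles (listed without repetition) of the rational functions $p_i/p_0$, $i=1,\dots,n$; the point $\infty$ is always included in $S$. Since $L$ is defined over $k$, the polynomial $\Delta$ has coefficients in $k$. $L$ is Fuchsian, i.e. it has only regular singularities on $\mathbb{P}^1$: $p_i/p_0$ has a pole of order at most $i$ at every finite point and vanishes to order at least $i$ at $\infty$. A solution $f$ is a (multivalued) holomorphic function on $\mathbb{C}\setminus\{t_1,\dots,t_r\}$ with $Lf=0$; one may fix a branch on a nonempty simply connected open set, and all differential forms below are regarded as holomorphic 1-forms there. Cohomology group (it depends on $f$, which is suppressed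 in the notation): $$H^1_{\mathrm{dR}}(\mathbb{P}^1-S,L):=\frac{\langle p f^{(i)}dx \mid p\in k(x),\ \mathrm{pol}(p)\subset S,\ i=0,1,\dots,n-1\rangle_k}{\langle d(pf^{(i)})\mid p\in k(x),\ \mathrm{pol}(p)\subset S,\ i=0,1,\dots,n-1\rangle_k},$$ where $\mathrm{pol}(p)$ is the set of poles of $p$ on $\mathbb{P}^1$ (over $\bar k$) and $\langle\cdot\rangle_k$ denotes $k$-linear span. Exponents: for a finite point $t$ put $a_{i,t}:=\lim_{x\to t}(x-t)^i\frac{p_i}{p_0}$, and put $a_{i,\infty}:=\lim_{x\to\infty}(-x)^i\frac{p_i}{p_0}$. The indicial polynomials are $$I_t(X)=X(X-1)\cdots(X-n+1)+a_{1,t}X(X-1)\cdots(X-n+2)+\cdots+a_{n,t},$$ $$I_\infty(X)=X(X+1)\cdots(X+n-1)+a_{1,\infty}X(X+1)\cdots(X+n-2)+\cdots+a_{n,\infty}.$$ The exponents of $L$ at $t$ (the Riemann scheme of $L$ at $t$) are the roots of $I_t$, for $t$ finite or $t=\infty$. *)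

theory Defs
  imports
    "HOL-Algebra.Algebraic_Closure_Type"
    "HOL-Complex_Analysis.Complex_Analysis"
begin

abbreviation complex_ring :: "complex ring" where
  "complex_ring \<equiv> ring_of_type_algebra"

abbreviation scalars :: "complex set \<Rightarrow> complex ring" where
  "scalars k \<equiv> complex_ring\<lparr>carrier := k\<rparr>"

section \<open>Polynomials and rational functions over a subfield of the complex numbers\<close>

definition polys_over :: "complex set \<Rightarrow> complex poly set" where
  "polys_over k = {q. \<forall>j. Polynomial.coeff q j \<in> k}"

definition ratfuns_over :: "complex set \<Rightarrow> complex poly fract set" where
  "ratfuns_over k = {Fract a b | a b. a \<in> polys_over k \<and> b \<in> polys_over k \<and> b \<noteq> 0}"

text \<open>Numerator and denominator in lowest terms, so that evaluation is
  meaningful outside the poles and removable singularities do not occur.\<close>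

abbreviation numer :: "complex poly fract \<Rightarrow> complex poly" where
  "numer q \<equiv> fst (quot_of_fract q)"

abbreviation denom :: "complex poly fract \<Rightarrow> complex poly" where
  "denom q \<equiv> snd (quot_of_fract q)"

definition ratfun_eval :: "complex poly fract \<Rightarrow> complex \<Rightarrow> complex" where
  "ratfun_eval q x = poly (numer q) x / poly (denom q) x"

definition finite_poles :: "complex poly fract \<Rightarrow> complex set" where
  "finite_poles q = {t. poly (denom q) t = 0}"

definition pole_mult :: "complex poly fract \<Rightarrow> complex \<Rightarrow> nat" where
  "pole_mult q t = Polynomial.order t (denom q)"

definition vanishes_at_infinity_to_order :: "complex poly fract \<Rightarrow> nat \<Rightarrow> bool" where
  "vanishes_at_infinity_to_order q i \<longleftrightarrow>
     q = 0 \<or> Polynomial.degree (numer q) + i \<le> Polynomial.degree (denom q)"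

section \<open>Fuchsian operators and their exponents\<close>

text \<open>The operator \<open>p\<^sub>0 \<partial>\<^sup>n + \<dots> + p\<^sub>n\<close> is given by \<open>n\<close> and the sequence \<open>p\<close>,
  of which only \<open>p 0, \<dots>, p n\<close> matter.\<close>

definition diffop :: "nat \<Rightarrow> (nat \<Rightarrow> complex poly) \<Rightarrow> (complex \<Rightarrow> complex) \<Rightarrow> complex \<Rightarrow> complex" where
  "diffop n p f x = (\<Sum>i\<le>n. poly (p i) x * (deriv ^^ (n - i)) f x)"

definition finite_sings :: "nat \<Rightarrow> (nat \<Rightarrow> complex poly) \<Rightarrow> complex set" where
  "finite_sings n p = (\<Union>i\<in>{1..n}. finite_poles (Fract (p i) (p 0)))"

definition fuchsian :: "nat \<Rightarrow> (nat \<Rightarrow> complex poly) \<Rightarrow> bool" where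
  "fuchsian n p \<longleftrightarrow> (\<forall>i\<in>{1..n}.
     (\<forall>t. pole_mult (Fract (p i) (p 0)) t \<le> i) \<and>
     vanishes_at_infinity_to_order (Fract (p i) (p 0)) i)"

definition Delta :: "nat \<Rightarrow> (nat \<Rightarrow> complex poly) \<Rightarrow> complex poly" where
  "Delta n p = (\<Prod>t\<in>finite_sings n p. [:- t, 1:])"

definition indicial_coeff :: "(nat \<Rightarrow> complex poly) \<Rightarrow> nat \<Rightarrow> complex \<Rightarrow> complex" where
  "indicial_coeff p i t = Lim (at t) (\<lambda>x. (x - t) ^ i * ratfun_eval (Fract (p i) (p 0)) x)"

definition indicial_coeff_inf :: "(nat \<Rightarrow> complex poly) \<Rightarrow> nat \<Rightarrow> complex" where
  "indicial_coeff_inf p i = Lim at_infinity (\<lambda>x. (- x) ^ i * ratfun_eval (Fract (p i) (p 0)) x)"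

definition indicial_poly :: "nat \<Rightarrow> (nat \<Rightarrow> complex poly) \<Rightarrow> complex \<Rightarrow> complex poly" where
  "indicial_poly n p t =
     (\<Prod>l<n. [:- of_nat l, 1:]) +
     (\<Sum>i=1..n. Polynomial.smult (indicial_coeff p i t) (\<Prod>l<n - i. [:- of_nat l, 1:]))"

definition indicial_poly_inf :: "nat \<Rightarrow> (nat \<Rightarrow> complex poly) \<Rightarrow> complex poly" where
  "indicial_poly_inf n p =
     (\<Prod>l<n. [:of_nat l, 1:]) +
     (\<Sum>i=1..n. Polynomial.smult (indicial_coeff_inf p i) (\<Prod>l<n - i. [:of_nat l, 1:]))"

definition exponents :: "nat \<Rightarrow> (nat \<Rightarrow> complex poly) \<Rightarrow> complex \<Rightarrow> complex set" where
  "exponents n p t = {e. poly (indicial_poly n p t) e = 0}"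

definition exponents_inf :: "nat \<Rightarrow> (nat \<Rightarrow> complex poly) \<Rightarrow> complex set" where
  "exponents_inf n p = {e. poly (indicial_poly_inf n p) e = 0}"

section \<open>Spans and quotients of modules\<close>

definition mspan :: "('a, 'r) ring_scheme \<Rightarrow> ('a, 'b, 'm) module_scheme \<Rightarrow> 'b set \<Rightarrow> 'b set" where
  "mspan R M G = (\<lambda>H. submodule H R M) hull G"

text \<open>The multiplicative fields of a module record are never used. Adding \<open>D\<close> in the
  scalar multiplication makes the result a full coset also for the zero scalar.\<close>

definition quot_module :: "('a, 'b, 'm) module_scheme \<Rightarrow> 'b set \<Rightarrow> ('a, 'b set) module" where
  "quot_module M D =
     \<lparr>carrier = a_rcosets\<^bsub>M\<^esub> D, monoid.mult = undefined, one = undefined,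
      ring.zero = D, add = set_add M,
      module.smult = (\<lambda>c A. D <+>\<^bsub>M\<^esub> {c \<odot>\<^bsub>M\<^esub> a | a. a \<in> A})\<rparr>"

section \<open>The de Rham cohomology group\<close>

text \<open>A holomorphic 1-form \<open>g dx\<close> on an open set \<open>U\<close> is represented by the function that
  is \<open>g\<close> on \<open>U\<close> and \<open>0\<close> elsewhere, so that equality of functions is equality of forms on \<open>U\<close>.\<close>

definition form_on :: "complex set \<Rightarrow> (complex \<Rightarrow> complex) \<Rightarrow> complex \<Rightarrow> complex" where
  "form_on U g = (\<lambda>x. if x \<in> U then g x else 0)"

definition holo_forms :: "complex set \<Rightarrow> (complex, complex \<Rightarrow> complex) module" where
  "holo_forms U =
     \<lparr>carrier = {form_on U g | g. g holomorphic_on U}, monoid.mult = undefined, one = undefined,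
      ring.zero = (\<lambda>x. 0), add = (\<lambda>g h x. g x + h x), module.smult = (\<lambda>c g x. c * g x)\<rparr>"

text \<open>As infinity always belongs to the set of singularities, the condition on the poles
  of \<open>q\<close> only concerns the finite ones.\<close>

definition twisted_forms ::
  "complex set \<Rightarrow> nat \<Rightarrow> (nat \<Rightarrow> complex poly) \<Rightarrow> (complex \<Rightarrow> complex) \<Rightarrow>
    complex set \<Rightarrow> (complex \<Rightarrow> complex) set" where
  "twisted_forms k n p f U = mspan (scalars k) (holo_forms U)
     {form_on U (\<lambda>x. ratfun_eval q x * (deriv ^^ i) f x) | q i.
        q \<in> ratfuns_over k \<and> finite_poles q \<subseteq> finite_sings n p \<and> i < n}"

definition exact_forms ::
  "complex set \<Rightarrow> nat \<Rightarrow> (nat \<Rightarrow> complex poly) \<Rightarrow> (complex \<Rightarrow> complex) \<Rightarrow>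
    complex set \<Rightarrow> (complex \<Rightarrow> complex) set" where
  "exact_forms k n p f U = mspan (scalars k) (holo_forms U)
     {form_on U (deriv (\<lambda>x. ratfun_eval q x * (deriv ^^ i) f x)) | q i.
        q \<in> ratfuns_over k \<and> finite_poles q \<subseteq> finite_sings n p \<and> i < n}"

definition H1dR ::
  "complex set \<Rightarrow> nat \<Rightarrow> (nat \<Rightarrow> complex poly) \<Rightarrow> (complex \<Rightarrow> complex) \<Rightarrow>
    complex set \<Rightarrow> (complex, (complex \<Rightarrow> complex) set) module" where
  "H1dR k n p f U =
     quot_module ((holo_forms U)\<lparr>carrier := twisted_forms k n p f U\<rparr>) (exact_forms k n p f U)"

definition form_class ::
  "complex set \<Rightarrow> nat \<Rightarrow> (nat \<Rightarrow> complex poly) \<Rightarrow> (complex \<Rightarrow> complex) \<Rightarrow>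
    complex set \<Rightarrow> (complex \<Rightarrow> complex) \<Rightarrow> (complex \<Rightarrow> complex) set" where
  "form_class k n p f U \<omega> = exact_forms k n p f U +>\<^bsub>holo_forms U\<^esub> \<omega>"

end

theory Submission
  imports Defs
begin

text \<open>Integration by parts gives \<open>q f\<^bsup>(i)\<^esup> dx \<equiv> (-1)\<^sup>i q\<^bsup>(i)\<^esup> f dx\<close> modulo exact forms, so every class is
  represented by some \<open>q f dx\<close> with \<open>q \<in> W = k[x, 1 / \<Delta>]\<close>. Let \<open>L\<close> be made monic by division by \<open>p\<^sub>0\<close>.
  Integrating \<open>u L f = 0\<close> by parts shows that \<open>L\<^sup>*(u) f dx\<close> is exact for \<open>u \<in> W\<close>, where \<open>L\<^sup>*\<close> is the
  formal adjoint (\<open>adj_in_Q\<close>). It remains to write each \<open>q \<in> W\<close> as \<open>L\<^sup>* u\<close> plus a \<open>k\<close>-combination of the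
  functions \<open>(x\<^sup>j / \<Delta>)\<^bsup>(i)\<^esup>\<close> with \<open>j < r\<close> and \<open>i < n\<close>.

  This is done by comparing leading terms. If \<open>u\<close> has a pole of order \<open>e \<ge> 1\<close> at a finite singularity
  \<open>t\<close>, then \<open>L\<^sup>* u\<close> has one of order \<open>e + n\<close>, and the leading coefficient is multiplied by the value
  \<open>I\<^sub>t(e + n - 1)\<close> of the indicial polynomial. It is nonzero because no integer \<open>\<ge> n\<close> is an exponent, and
  so all poles of order above \<open>n\<close> can be removed (\<open>high_pole_in_Q\<close>). Likewise the leading coefficient
  of \<open>L\<^sup>* x\<^bsup>m+n\<^esup>\<close> at infinity is \<open>\<plusminus> I\<^sub>\<infinity>(m + 1) \<noteq> 0\<close>, and its finite poles have order at most \<open>n\<close>, so \<open>q\<close>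
  can be made to vanish at infinity (\<open>pole_order_n_in_Q\<close>). What is left is \<open>a / \<Delta>\<^sup>n\<close> with
  \<open>deg a < n r\<close>. Such a function is a combination of the \<open>(x\<^sup>j / \<Delta>)\<^bsup>(i)\<^esup>\<close>, again by removing poles, now
  from order \<open>n\<close> down to \<open>0\<close> (\<open>low_degree_in_Q\<close>).

  The singularities need not be in \<open>k\<close>, so the leading terms cannot be treated one point at a time.
  But \<open>\<Delta>\<close> has coefficients in \<open>k\<close> (\<open>Delta_P\<close>), and the conditions on leading coefficients at all
  its roots together amount to a congruence \<open>w b \<equiv> a\<close> modulo \<open>\<Delta>\<close> in \<open>k[x]\<close>. The factor \<open>w\<close> has no
  root in common with \<open>\<Delta>\<close>, so it is invertible modulo \<open>\<Delta>\<close> over \<open>k\<close> (\<open>P_inverse_mod\<close>).\<close>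

section \<open>Polynomials and rational functions over a subfield of the complex numbers\<close>

locale complex_subfield =
  fixes k :: "complex set"
  assumes subfield_k: "subfield k complex_ring"
begin

interpretation C: field complex_ring
  by (rule field_from_type_algebra)

lemma zero_mem [simp]: "0 \<in> k"
  and one_mem [simp]: "1 \<in> k"
  and add_mem: "a \<in> k \<Longrightarrow> b \<in> k \<Longrightarrow> a + b \<in> k"
  and mult_mem: "a \<in> k \<Longrightarrow> b \<in> k \<Longrightarrow> a * b \<in> k"
  and uminus_mem: "a \<in> k \<Longrightarrow> - a \<in> k"
proof -
  note sub = subringE[OF subfieldE(1)[OF subfield_k]]
  show "0 \<in> k" "1 \<in> k"
    using sub(2,3) by (simp_all add: ring_of_type_algebra_def)
  show "a \<in> k \<Longrightarrow> b \<in> k \<Longrightarrow> a + b \<in> k" "a \<in> k \<Longrightarrow> b \<in> k \<Longrightarrow> a * b \<in> k"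
    using sub(6,7)[of a b] by (simp_all add: ring_of_type_algebra_def)
  assume a: "a \<in> k"
  have "\<ominus>\<^bsub>complex_ring\<^esub> a = - a"
    by (rule C.minus_equality) (simp_all add: ring_of_type_algebra_def)
  with sub(5)[OF a] show "- a \<in> k" by simp
qed

lemma inverse_mem: "a \<in> k \<Longrightarrow> inverse a \<in> k"
proof (cases "a = 0")
  case False
  assume a: "a \<in> k"
  with False have *: "a \<in> k - {\<zero>\<^bsub>complex_ring\<^esub>}"
    by (simp add: ring_of_type_algebra_def)
  from C.subfield_m_inv[OF subfield_k *]
  have "inv\<^bsub>complex_ring\<^esub> a \<in> k" "a * inv\<^bsub>complex_ring\<^esub> a = 1"
    by (simp_all add: ring_of_type_algebra_def)
  moreover from this(2) have "inv\<^bsub>complex_ring\<^esub> a = inverse a"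
    by (metis inverse_unique)
  ultimately show ?thesis by simp
qed simp

lemma diff_mem: "a \<in> k \<Longrightarrow> b \<in> k \<Longrightarrow> a - b \<in> k"
  using add_mem[of a "- b"] uminus_mem[of b] by simp

lemma divide_mem: "a \<in> k \<Longrightarrow> b \<in> k \<Longrightarrow> a / b \<in> k"
  using mult_mem[of a "inverse b"] inverse_mem[of b] by (simp add: divide_inverse)

lemma of_nat_mem [simp]: "of_nat m \<in> k"
  by (induction m) (auto intro: add_mem)

lemma sum_mem: "(\<And>i. i \<in> A \<Longrightarrow> g i \<in> k) \<Longrightarrow> sum g A \<in> k"
  by (induction A rule: infinite_finite_induct) (auto intro: add_mem)

abbreviation P :: "complex poly set" where "P \<equiv> polys_over k"

lemma coeff_mem: "a \<in> P \<Longrightarrow> Polynomial.coeff a j \<in> k"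
  by (simp add: polys_over_def)

lemma P_0 [simp]: "0 \<in> P" and P_1 [simp]: "1 \<in> P"
  by (auto simp: polys_over_def)

lemma P_monom: "c \<in> k \<Longrightarrow> Polynomial.monom c m \<in> P"
  by (auto simp: polys_over_def)

lemma P_add: "a \<in> P \<Longrightarrow> b \<in> P \<Longrightarrow> a + b \<in> P"
  and P_diff: "a \<in> P \<Longrightarrow> b \<in> P \<Longrightarrow> a - b \<in> P"
  and P_uminus: "a \<in> P \<Longrightarrow> - a \<in> P"
  and P_smult: "c \<in> k \<Longrightarrow> a \<in> P \<Longrightarrow> Polynomial.smult c a \<in> P"
  and P_mult: "a \<in> P \<Longrightarrow> b \<in> P \<Longrightarrow> a * b \<in> P"
  and P_pderiv: "a \<in> P \<Longrightarrow> pderiv a \<in> P"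
  by (auto simp: polys_over_def coeff_mult coeff_pderiv simp del: of_nat_Suc
      intro!: add_mem diff_mem uminus_mem mult_mem sum_mem)

lemma P_power: "a \<in> P \<Longrightarrow> a ^ m \<in> P"
  by (induction m) (auto intro: P_mult)

lemma P_sum: "(\<And>i. i \<in> A \<Longrightarrow> g i \<in> P) \<Longrightarrow> sum g A \<in> P"
  by (induction A rule: infinite_finite_induct) (auto intro: P_add)

lemma P_prod: "(\<And>i. i \<in> A \<Longrightarrow> g i \<in> P) \<Longrightarrow> prod g A \<in> P"
  by (induction A rule: infinite_finite_induct) (auto intro: P_mult)

text \<open>The only inversion in polynomial division is that of the leading coefficient of the divisor,
  so it can be carried out over \<open>k\<close>. As quotient and remainder are unique, the operations
  \<open>div\<close> and \<open>mod\<close> of \<open>\<complex>[x]\<close>, and with them Euclid's algorithm, preserve \<open>k[x]\<close>.\<close>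

lemma P_division:
  assumes "a \<in> P" "b \<in> P" "b \<noteq> 0"
  shows "\<exists>q\<in>P. a - q * b = 0 \<or> Polynomial.degree (a - q * b) < Polynomial.degree b"
  using assms(1)
proof (induction "Polynomial.degree a" arbitrary: a rule: less_induct)
  case less
  show ?case
  proof (cases "Polynomial.degree a < Polynomial.degree b \<or> a = 0")
    case True
    then show ?thesis by (intro bexI[of _ 0]) auto
  next
    case False
    define m where "m = Polynomial.monom (lead_coeff a / lead_coeff b)
      (Polynomial.degree a - Polynomial.degree b)"
    have mP: "m \<in> P" unfolding m_def
      by (intro P_monom divide_mem coeff_mem less.prems assms)
    have dm: "Polynomial.degree (m * b) = Polynomial.degree a"
    proof (cases "a = 0")
      case nz: False
      with assms(3) have c: "lead_coeff a / lead_coeff b \<noteq> 0" by simp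
      have "Polynomial.degree m = Polynomial.degree a - Polynomial.degree b"
        unfolding m_def by (rule degree_monom_eq) (rule c)
      moreover have "m \<noteq> 0"
        unfolding m_def monom_eq_0_iff by (rule c)
      ultimately show ?thesis using False assms(3) by (simp add: degree_mult_eq)
    qed (use False in auto)
    have lm: "Polynomial.coeff (m * b) (Polynomial.degree a) = lead_coeff a"
    proof -
      have "lead_coeff m = lead_coeff a / lead_coeff b"
        unfolding m_def by (rule lead_coeff_monom)
      hence "lead_coeff (m * b) = lead_coeff a"
        using assms(3) by (simp add: lead_coeff_mult)
      with dm show ?thesis by simp
    qed
    show ?thesis
    proof (cases "a - m * b = 0")
      case True
      with mP show ?thesis by blast
    next
      case nz: False
      have "Polynomial.degree (a - m * b) < Polynomial.degree a"
      proof -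
        have "Polynomial.degree (a - m * b) \<le> Polynomial.degree a"
          by (rule degree_diff_le) (use dm in simp_all)
        moreover have "Polynomial.degree (a - m * b) \<noteq> Polynomial.degree a"
        proof
          assume "Polynomial.degree (a - m * b) = Polynomial.degree a"
          moreover have "Polynomial.coeff (a - m * b) (Polynomial.degree a) = 0"
            using lm by simp
          ultimately show False using nz by (metis leading_coeff_0_iff)
        qed
        ultimately show ?thesis by simp
      qed
      from less.hyps[OF this P_diff[OF less.prems P_mult[OF mP assms(2)]]]
      obtain q where q: "q \<in> P" "a - m * b - q * b = 0 \<or>
        Polynomial.degree (a - m * b - q * b) < Polynomial.degree b" by blast
      have "a - m * b - q * b = a - (m + q) * b" by (simp add: algebra_simps)
      with q P_add[OF mP q(1)] show ?thesis by metis
    qed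
  qed
qed

lemma P_div: "a \<in> P \<Longrightarrow> b \<in> P \<Longrightarrow> a div b \<in> P"
  and P_mod: "a \<in> P \<Longrightarrow> b \<in> P \<Longrightarrow> a mod b \<in> P"
proof -
  assume ab: "a \<in> P" "b \<in> P"
  show "a div b \<in> P"
  proof (cases "b = 0")
    case False
    from P_division[OF ab False] obtain q where q: "q \<in> P" "a - q * b = 0 \<or>
        Polynomial.degree (a - q * b) < Polynomial.degree b" by blast
    have "a div b = (q * b + (a - q * b)) div b" by simp
    also have "\<dots> = q + (a - q * b) div b"
      using False by (rule div_mult_self3)
    also have "(a - q * b) div b = 0"
      using q(2) by (auto simp: div_poly_less)
    finally show ?thesis using q(1) by simp
  qed simp
  thus "a mod b \<in> P"
    unfolding minus_div_mult_eq_mod [symmetric] using ab by (intro P_diff P_mult)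
qed

lemma P_bezout:
  "a \<in> P \<Longrightarrow> b \<in> P \<Longrightarrow>
    \<exists>u\<in>P. \<exists>v\<in>P. (u * a + v * b) dvd a \<and> (u * a + v * b) dvd b"
proof (induction a b rule: eucl_induct)
  case (zero a)
  show ?case by (rule bexI[of _ 1], rule bexI[of _ 0]) auto
next
  case (mod a b)
  from mod obtain u v where uv: "u \<in> P" "v \<in> P"
    "(u * b + v * (a mod b)) dvd b" "(u * b + v * (a mod b)) dvd (a mod b)"
    by (auto intro: P_mod)
  have eq: "u * b + v * (a mod b) = v * a + (u - v * (a div b)) * b"
    unfolding minus_div_mult_eq_mod [symmetric] by (simp add: algebra_simps)
  have "(u * b + v * (a mod b)) dvd a"
    using uv(3,4) by (metis dvd_mod_iff)
  with uv mod.prems show ?case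
    unfolding eq by (intro bexI[of _ v] bexI[of _ "u - v * (a div b)"]) (auto intro: P_diff P_mult P_div)
qed

lemma P_gcd: 
  assumes "a \<in> P" "b \<in> P" shows "gcd a b \<in> P"
proof -
  from P_bezout[OF assms] obtain u v where uv: "u \<in> P" "v \<in> P"
    "(u * a + v * b) dvd a" "(u * a + v * b) dvd b" by blast
  define d where "d = u * a + v * b"
  have "gcd a b = normalize d"
    by (rule gcdI [symmetric]) (use uv in \<open>auto simp: d_def\<close>)
  also have "\<dots> = Polynomial.smult (inverse (lead_coeff d)) d"
    by (rule poly_eqI) (simp add: field_simps)
  finally have gcd: "gcd a b = Polynomial.smult (inverse (lead_coeff d)) d" .
  have "d \<in> P" unfolding d_def using uv assms by (intro P_add P_mult)
  thus ?thesis unfolding gcd by (intro P_smult inverse_mem coeff_mem)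
qed

text \<open>The hypothesis is about the complex roots, the conclusion about \<open>k[x]\<close>. This lemma is what
  allows residues at conjugate singularities to be corrected all at once, without leaving \<open>k\<close>:
  the Bezout combination of \<open>c\<close> and \<open>D\<close> has no complex root, hence is a nonzero constant of \<open>k\<close>.\<close>

lemma P_inverse_mod:
  assumes "c \<in> P" "D \<in> P" "\<And>t. poly D t = 0 \<Longrightarrow> poly c t \<noteq> 0"
  obtains u where "u \<in> P" "D dvd 1 - u * c"
proof -
  from P_bezout[OF assms(1,2)] obtain u v where uv: "u \<in> P" "v \<in> P"
    "(u * c + v * D) dvd c" "(u * c + v * D) dvd D" by blast
  define d where "d = u * c + v * D"
  have noroot: "poly d t \<noteq> 0" for t
  proof
    assume "poly d t = 0"
    with uv(3,4) have "poly c t = 0" "poly D t = 0"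
      unfolding d_def [symmetric] by (meson dvd_trans poly_eq_0_iff_dvd)+
    with assms(3) show False by blast
  qed
  have "\<not> \<not> constant (poly d)"
    using Fundamental_Theorem_Algebra.fundamental_theorem_of_algebra[of d] noroot by auto
  hence "Polynomial.degree d = 0" by (simp add: constant_degree)
  then obtain e where e: "d = [:e:]" by (rule degree_eq_zeroE)
  with noroot[of 0] have "e \<noteq> 0" by auto
  note e = e this
  have "Polynomial.coeff d 0 \<in> k"
    unfolding d_def using uv assms by (intro coeff_mem P_add P_mult)
  hence ek: "e \<in> k" by (simp add: e)
  show ?thesis
  proof (rule that)
    show "Polynomial.smult (inverse e) u \<in> P" using ek uv by (intro P_smult inverse_mem)
    have "1 = Polynomial.smult (inverse e) d"
      using e by simp
    hence "1 - Polynomial.smult (inverse e) u * c =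
        Polynomial.smult (inverse e) d - Polynomial.smult (inverse e) u * c" by (rule arg_cong)
    also have "\<dots> = D * Polynomial.smult (inverse e) v"
      by (simp add: d_def smult_add_right mult.commute)
    finally have "1 - Polynomial.smult (inverse e) u * c = D * Polynomial.smult (inverse e) v" .
    thus "D dvd 1 - Polynomial.smult (inverse e) u * c" by (rule dvdI)
  qed
qed

lemma numer_denom_P:
  assumes "q \<in> ratfuns_over k"
  shows "numer q \<in> P" "denom q \<in> P"
proof -
  from assms obtain a b where q: "q = Fract a b" "a \<in> P" "b \<in> P" "b \<noteq> 0"
    by (auto simp: ratfuns_over_def)
  have "quot_of_fract q = normalize_quot (a, b)"
    unfolding q(1) by transfer (use q in simp)
  moreover have "gcd a b * unit_factor b \<in> P"
    unfolding unit_factor_poly_def using q by (simp add: P_smult P_gcd coeff_mem)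
  ultimately show "numer q \<in> P" "denom q \<in> P"
    using q by (simp_all add: normalize_quot_def Let_def P_div)
qed

end

section \<open>Divisibility, lowest terms and limits\<close>

lemma complex_poly_dvd_if_order_le:
  fixes a b :: "complex poly"
  assumes "a \<noteq> 0" "\<And>t. Polynomial.order t a \<le> Polynomial.order t b"
  shows "a dvd b"
proof (cases "b = 0")
  case False
  let ?R = "\<lambda>q. {z. poly q z = 0}"
  have "?R a \<subseteq> ?R b"
  proof safe
    fix z assume "poly a z = 0"
    hence "Polynomial.order z a \<noteq> 0" using assms(1) by (simp add: order_root)
    with assms(2)[of z] have "Polynomial.order z b \<noteq> 0" by linarith
    thus "poly b z = 0" by (simp add: order_root)
  qed
  moreover have "finite (?R b)" using False by (rule poly_roots_finite)
  ultimately have "(\<Prod>z\<in>?R a. [:- z, 1:] ^ Polynomial.order z a) dvd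
      (\<Prod>z\<in>?R b. [:- z, 1:] ^ Polynomial.order z b)"
    using assms by (intro prod_dvd_prod_subset2) (auto intro: le_imp_power_dvd)
  hence "Polynomial.smult (lead_coeff a) (\<Prod>z\<in>?R a. [:- z, 1:] ^ Polynomial.order z a) dvd
      Polynomial.smult (lead_coeff b) (\<Prod>z\<in>?R b. [:- z, 1:] ^ Polynomial.order z b)"
    using assms False by (simp add: smult_dvd_iff dvd_smult)
  thus ?thesis by (simp only: complex_poly_decompose)
qed simp

lemma numer_denom_Fract:
  assumes "b \<noteq> 0"
  shows "numer (Fract a b) * b = a * denom (Fract a b)" "denom (Fract a b) dvd b"
proof -
  have "Fract (numer (Fract a b)) (denom (Fract a b)) = Fract a b"
    by (rule Fract_quot_of_fract)
  thus *: "numer (Fract a b) * b = a * denom (Fract a b)"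
    using assms by (subst (asm) eq_fract) auto
  have "coprime (denom (Fract a b)) (numer (Fract a b))"
    by (metis coprime_commute coprime_quot_of_fract)
  moreover have "denom (Fract a b) dvd numer (Fract a b) * b"
    unfolding * by simp
  ultimately show "denom (Fract a b) dvd b"
    by (simp add: coprime_dvd_mult_right_iff)
qed

lemma tendsto_poly_div_power_at_infinity:
  fixes q :: "complex poly"
  assumes "Polynomial.degree q \<le> N"
  shows "((\<lambda>x. poly q x / x ^ N) \<longlongrightarrow> Polynomial.coeff q N) at_infinity"
  using assms
proof (induction q arbitrary: N)
  case (pCons a q)
  show ?case
  proof (cases N)
    case 0
    with pCons have "q = 0" by (auto split: if_splits)
    with 0 show ?thesis by simp
  next
    case (Suc M)
    have "((\<lambda>x. a * inverse x ^ N + poly q x / x ^ M) \<longlongrightarrow> a * 0 ^ N + Polynomial.coeff q M) at_infinity"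
      using pCons Suc by (intro tendsto_intros tendsto_inverse_0) (auto split: if_splits)
    moreover have "\<forall>\<^sub>F x::complex in at_infinity. x \<noteq> 0"
      by (auto simp: eventually_at_infinity intro!: exI[of _ 1])
    hence "\<forall>\<^sub>F x in at_infinity. a * inverse x ^ N + poly q x / x ^ M = poly (pCons a q) x / x ^ N"
      by eventually_elim (simp add: Suc power_inverse divide_inverse distrib_right)
    ultimately show ?thesis
      using Suc by (subst (asm) filterlim_cong[OF refl refl]) auto
  qed
qed auto

section \<open>A Fuchsian operator in monic form\<close>

locale fuchsian_operator = complex_subfield +
  fixes n :: nat and p :: "nat \<Rightarrow> complex poly"
  assumes p_P: "i \<le> n \<Longrightarrow> p i \<in> P"
    and p0: "p 0 \<noteq> 0"
    and fuchs: "fuchsian n p"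
begin

abbreviation S :: "complex set" where "S \<equiv> finite_sings n p"
abbreviation \<Delta> :: "complex poly" where "\<Delta> \<equiv> Delta n p"
abbreviation r :: nat where "r \<equiv> card S"

text \<open>After division by \<open>p\<^sub>0\<close> the coefficients of the operator are \<open>p\<^sub>i / p\<^sub>0 = c\<^sub>i / \<Delta>\<^sup>i\<close>: the Fuchs
  condition at the finite singularities bounds the pole orders by \<open>i\<close>, and the one at infinity
  bounds the degree of \<open>c\<^sub>i\<close>.\<close>

definition c :: "nat \<Rightarrow> complex poly" where
  "c i = numer (Fract (p i) (p 0)) * (\<Delta> ^ i div denom (Fract (p i) (p 0)))"

lemma finite_S: "finite S"
  unfolding finite_sings_def finite_poles_def by (auto intro!: poly_roots_finite)

lemma Delta_root_iff [simp]: "poly \<Delta> t = 0 \<longleftrightarrow> t \<in> S"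
  unfolding Delta_def using finite_S by (auto simp: poly_prod)

lemma Delta_nz [simp]: "\<Delta> \<noteq> 0"
  unfolding Delta_def using finite_S by auto

lemma degree_Delta: "Polynomial.degree \<Delta> = r"
  unfolding Delta_def by (subst degree_prod_sum_eq) auto

lemma lead_coeff_Delta: "lead_coeff \<Delta> = 1"
  unfolding Delta_def by (simp add: lead_coeff_prod)

text \<open>The cofactor \<open>E\<close> has at \<open>t\<close> the value \<open>\<Delta>'(t)\<close>; in the exponents at \<open>t\<close> it is \<open>E(t)\<close> that occurs,
  in the derivatives of \<open>b / \<Delta>\<^sup>e\<close> it is \<open>\<Delta>'(t)\<close>.\<close>

lemma Delta_factor:
  assumes "t \<in> S"
  obtains E where "\<Delta> = [:- t, 1:] * E" "poly E t = poly (pderiv \<Delta>) t" "poly E t \<noteq> 0"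
proof
  let ?E = "\<Prod>s\<in>S - {t}. [:- s, 1:]"
  show *: "\<Delta> = [:- t, 1:] * ?E"
    unfolding Delta_def by (rule prod.remove) (use finite_S assms in auto)
  show "poly ?E t = poly (pderiv \<Delta>) t"
    unfolding * pderiv_mult by (simp add: pderiv_pCons)
  show "poly ?E t \<noteq> 0" using finite_S by (auto simp: poly_prod)
qed

lemma p_frac: "i \<le> n \<Longrightarrow> Fract (p i) (p 0) \<in> ratfuns_over k"
  using p_P[of i] p_P[of 0] p0 by (auto simp: ratfuns_over_def)

text \<open>The singularities need not lie in \<open>k\<close>. But \<open>\<Delta>\<close> is, up to a constant, the squarefree part
  \<open>D / gcd(D, D')\<close> of the product \<open>D\<close> of the denominators, and that can be computed over \<open>k\<close>.\<close>

lemma Delta_P: "\<Delta> \<in> P"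
proof -
  define D where "D = (\<Prod>i\<in>{1..n}. denom (Fract (p i) (p 0)))"
  have DP: "D \<in> P" unfolding D_def by (intro P_prod numer_denom_P p_frac) auto
  have D0: "D \<noteq> 0" by (simp add: D_def)
  have roots: "poly D t = 0 \<longleftrightarrow> t \<in> S" for t
    by (auto simp: D_def poly_prod finite_sings_def finite_poles_def)
  show ?thesis
  proof (cases "pderiv D = 0")
    case True
    then obtain h where "D = [:h:]" using pderiv_iszero by blast
    with D0 roots have "S = {}" by auto
    thus ?thesis by (simp add: Delta_def)
  next
    case False
    from P_bezout[OF DP P_pderiv[OF DP]] obtain u v where uv: "u \<in> P" "v \<in> P"
      "(u * D + v * pderiv D) dvd D" "(u * D + v * pderiv D) dvd pderiv D" by blast
    define d where "d = u * D + v * pderiv D"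
    have dP: "d \<in> P" unfolding d_def by (intro P_add P_mult P_pderiv DP uv)
    define q where "q = D div d"
    have q: "D = q * d" using uv(3) by (simp add: q_def d_def)
    have qP: "q \<in> P" unfolding q_def by (intro P_div DP dP)
    have sq: "rsquarefree q \<and> (\<forall>a. poly q a = 0 \<longleftrightarrow> poly D a = 0)"
    proof (rule poly_squarefree_decomp[OF False q])
      show "pderiv D = (pderiv D div d) * d" using uv(4) by (simp add: d_def)
      show "d = u * D + v * pderiv D" by (simp add: d_def)
    qed
    have "{z. poly q z = 0} = S" using sq roots by auto
    hence "Polynomial.smult (lead_coeff q) \<Delta> = q"
      using complex_poly_decompose_rsquarefree[of q] sq by (simp add: Delta_def)
    moreover have "lead_coeff q \<noteq> 0" using q D0 by auto
    ultimately have "\<Delta> = Polynomial.smult (inverse (lead_coeff q)) q"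
      by (metis smult_smult left_inverse smult_1_left)
    also have "\<dots> \<in> P" using qP by (intro P_smult inverse_mem coeff_mem)
    finally show ?thesis .
  qed
qed

lemma denom_dvd_Delta_power:
  assumes "finite_poles q \<subseteq> S" "\<And>t. pole_mult q t \<le> e"
  shows "denom q dvd \<Delta> ^ e"
proof (rule complex_poly_dvd_if_order_le)
  fix t
  show "Polynomial.order t (denom q) \<le> Polynomial.order t (\<Delta> ^ e)"
  proof (cases "poly (denom q) t = 0")
    case True
    with assms(1) have "t \<in> S" by (auto simp: finite_poles_def)
    then obtain E where "\<Delta> = [:- t, 1:] * E" by (rule Delta_factor)
    hence "[:- t, 1:] ^ e dvd \<Delta> ^ e" by (intro dvd_power_same dvdI)
    hence "e \<le> Polynomial.order t (\<Delta> ^ e)" by (simp add: order_divides)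
    with assms(2)[of t] show ?thesis by (simp add: pole_mult_def)
  next
    case False
    hence "Polynomial.order t (denom q) = 0" by (simp add: order_root)
    thus ?thesis by simp
  qed
qed simp

lemma denom_dvd:
  assumes "i \<le> n"
  shows "denom (Fract (p i) (p 0)) dvd \<Delta> ^ i"
proof (cases "i = 0")
  case True
  with p0 have "Fract (p i) (p 0) = 1" unfolding One_fract_def by (subst eq_fract) auto
  thus ?thesis by simp
next
  case False
  show ?thesis
  proof (rule denom_dvd_Delta_power)
    show "finite_poles (Fract (p i) (p 0)) \<subseteq> S"
      unfolding finite_sings_def using False assms by (intro UN_upper) auto
    show "pole_mult (Fract (p i) (p 0)) t \<le> i" for t
      using False assms fuchs by (auto simp: fuchsian_def)
  qed
qed

lemma c_0: "c 0 = 1"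
proof -
  from p0 have "Fract (p 0) (p 0) = 1" unfolding One_fract_def by (subst eq_fract) auto
  thus ?thesis by (simp add: c_def)
qed

lemma c_P: "i \<le> n \<Longrightarrow> c i \<in> P"
  unfolding c_def by (intro P_mult P_div P_power Delta_P numer_denom_P p_frac)

lemma c_eq:
  assumes "i \<le> n"
  shows "p i * \<Delta> ^ i = c i * p 0"
proof -
  let ?N = "numer (Fract (p i) (p 0))" and ?D = "denom (Fract (p i) (p 0))"
  from denom_dvd[OF assms] obtain b where b: "\<Delta> ^ i = ?D * b" by (rule dvdE)
  have "\<Delta> ^ i div ?D = b" unfolding b by simp
  hence "c i * p 0 = (?N * p 0) * b" by (simp add: c_def mult_ac)
  also have "?N * p 0 = p i * ?D" by (rule numer_denom_Fract(1)[OF p0])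
  also have "\<dots> * b = p i * \<Delta> ^ i" by (simp only: b mult.assoc)
  finally show ?thesis by simp
qed

lemma ratfun_eval_c:
  assumes "i \<le> n" "x \<notin> S"
  shows "ratfun_eval (Fract (p i) (p 0)) x = poly (c i) x / poly \<Delta> x ^ i"
proof -
  let ?D = "denom (Fract (p i) (p 0))"
  from denom_dvd[OF assms(1)] obtain b where b: "\<Delta> ^ i = ?D * b" by (rule dvdE)
  have c: "c i = numer (Fract (p i) (p 0)) * b" unfolding c_def b by simp
  have "poly (\<Delta> ^ i) x = poly ?D x * poly b x" by (simp only: b poly_mult)
  moreover from assms have "poly (\<Delta> ^ i) x \<noteq> 0" by simp
  ultimately show ?thesis
    by (simp add: c ratfun_eval_def) 
qed

text \<open>The factor \<open>x\<^sup>i\<close> avoids a subtraction of degrees, and keeps the statement meaningful when there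
  is no finite singularity (then \<open>r = 0\<close>, and \<open>c\<^sub>i\<close> vanishes for \<open>i > 0\<close>).\<close>

lemma c_degree:
  assumes "i \<le> n"
  shows "Polynomial.degree (Polynomial.monom 1 i * c i) \<le> i * r"
proof (cases "i = 0 \<or> p i = 0")
  case True
  thus ?thesis
  proof
    assume "p i = 0"
    hence "Fract (p i) (p 0) = 0" by (simp add: fract_collapse)
    thus ?thesis by (simp add: c_def)
  qed (simp add: c_0)
next
  case False
  let ?N = "numer (Fract (p i) (p 0))" and ?D = "denom (Fract (p i) (p 0))"
  from denom_dvd[OF assms] obtain b where b: "\<Delta> ^ i = ?D * b" by (rule dvdE)
  have c: "c i = ?N * b" unfolding c_def b by simp
  have "Fract (p i) (p 0) \<noteq> 0"
    unfolding Zero_fract_def using False p0 by (subst eq_fract) auto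
  hence "Polynomial.degree ?N + i \<le> Polynomial.degree ?D" "?N \<noteq> 0"
    using fuchs False assms by (auto simp: fuchsian_def vanishes_at_infinity_to_order_def)
  moreover have "b \<noteq> 0" using b by auto
  moreover have "i * r = Polynomial.degree (\<Delta> ^ i)" by (simp add: degree_power_eq degree_Delta)
  ultimately show ?thesis
    by (simp add: c b degree_mult_eq degree_monom_eq)
qed

lemma ratfun_as_Delta_fraction:
  assumes "q \<in> ratfuns_over k" "finite_poles q \<subseteq> S"
  obtains a e where "a \<in> P" "\<And>x. x \<notin> S \<Longrightarrow> ratfun_eval q x = poly a x / poly \<Delta> x ^ e"
proof -
  have "denom q dvd \<Delta> ^ Polynomial.degree (denom q)"
    by (rule denom_dvd_Delta_power) (use assms in \<open>auto simp: pole_mult_def intro: order_degree\<close>)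
  then obtain b where b: "\<Delta> ^ Polynomial.degree (denom q) = denom q * b" by (rule dvdE)
  have "b = \<Delta> ^ Polynomial.degree (denom q) div denom q" unfolding b by simp
  hence bP: "b \<in> P" by (metis P_div P_power Delta_P numer_denom_P(2) assms(1))
  show ?thesis
  proof (rule that)
    show "numer q * b \<in> P" using bP assms by (intro P_mult numer_denom_P)
    fix x assume "x \<notin> S"
    hence "poly \<Delta> x ^ Polynomial.degree (denom q) \<noteq> 0" by simp
    moreover have "poly \<Delta> x ^ Polynomial.degree (denom q) = poly (denom q) x * poly b x"
      by (simp only: b poly_mult flip: poly_power)
    ultimately show "ratfun_eval q x = poly (numer q * b) x / poly \<Delta> x ^ Polynomial.degree (denom q)"
      unfolding ratfun_eval_def poly_mult by auto
  qed
qed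

lemma Delta_fraction_as_ratfun:
  assumes "a \<in> P"
  obtains q where "q \<in> ratfuns_over k" "finite_poles q \<subseteq> S"
    "\<And>x. x \<notin> S \<Longrightarrow> ratfun_eval q x = poly a x / poly \<Delta> x ^ e"
proof
  let ?q = "Fract a (\<Delta> ^ e)"
  show "?q \<in> ratfuns_over k"
    unfolding ratfuns_over_def using assms P_power[OF Delta_P, of e] Delta_nz power_not_zero by blast
  have dvd: "denom ?q dvd \<Delta> ^ e" by (rule numer_denom_Fract) simp
  have nz: "poly (denom ?q) x \<noteq> 0" if "x \<notin> S" for x
  proof
    assume "poly (denom ?q) x = 0"
    with dvd have "poly (\<Delta> ^ e) x = 0" by (meson dvd_trans poly_eq_0_iff_dvd)
    with that show False by simp
  qed
  thus "finite_poles ?q \<subseteq> S" by (auto simp: finite_poles_def)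
  fix x assume x: "x \<notin> S"
  have "poly (numer ?q * \<Delta> ^ e) x = poly (a * denom ?q) x"
    by (subst numer_denom_Fract) simp_all
  with nz[OF x] x show "ratfun_eval ?q x = poly a x / poly \<Delta> x ^ e"
    by (simp add: ratfun_eval_def frac_eq_eq)
qed

lemma indicial_coeff_eq:
  assumes "i \<le> n" "t \<in> S"
  shows "indicial_coeff p i t = poly (c i) t / poly (pderiv \<Delta>) t ^ i"
proof -
  from assms(2) obtain E where E: "\<Delta> = [:- t, 1:] * E" "poly E t = poly (pderiv \<Delta>) t" "poly E t \<noteq> 0"
    by (rule Delta_factor)
  have "((\<lambda>x. poly (c i) x / poly E x ^ i) \<longlongrightarrow> poly (c i) t / poly E t ^ i) (at t)"
    using E(3) by (intro tendsto_intros) auto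
  moreover have "\<forall>\<^sub>F x in at t. x \<notin> S - {t}"
  proof -
    have "open (- (S - {t}))" using finite_S by (intro open_Compl finite_imp_closed) auto
    thus ?thesis unfolding eventually_at_topological by (intro exI[of _ "- (S - {t})"]) simp
  qed
  hence "\<forall>\<^sub>F x in at t. x \<noteq> t \<and> x \<notin> S"
    using eventually_neq_at_within[of t t UNIV] by eventually_elim auto
  hence "\<forall>\<^sub>F x in at t. poly (c i) x / poly E x ^ i = (x - t) ^ i * ratfun_eval (Fract (p i) (p 0)) x"
  proof eventually_elim
    case (elim x)
    hence "poly E x \<noteq> 0" using Delta_root_iff[of x] unfolding E(1) by auto
    have "ratfun_eval (Fract (p i) (p 0)) x = poly (c i) x / ((x - t) * poly E x) ^ i"
      unfolding ratfun_eval_c[OF assms(1) conjunct2[OF elim]] by (subst E(1), subst poly_mult) simp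
    with elim show ?case by (simp add: power_mult_distrib)
  qed
  ultimately have "((\<lambda>x. (x - t) ^ i * ratfun_eval (Fract (p i) (p 0)) x) \<longlongrightarrow>
      poly (c i) t / poly E t ^ i) (at t)"
    by (rule Lim_transform_eventually)
  thus ?thesis unfolding indicial_coeff_def E(2) [symmetric] by (intro tendsto_Lim) auto
qed

text \<open>The limit of \<open>x\<^sup>i p\<^sub>i / p\<^sub>0\<close> at infinity: a quotient of two polynomials of degree at most \<open>i r\<close>, the
  second of which is \<open>\<Delta>\<^sup>i\<close> and monic.\<close>

definition c_inf :: "nat \<Rightarrow> complex" where
  "c_inf i = Polynomial.coeff (Polynomial.monom 1 i * c i) (i * r)"

lemma indicial_coeff_inf_eq:
  assumes "i \<le> n"
  shows "indicial_coeff_inf p i = (- 1) ^ i * c_inf i"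
proof -
  have "Polynomial.coeff (\<Delta> ^ i) (i * r) = 1"
    using lead_coeff_power[of \<Delta> i] lead_coeff_Delta
    by (simp only: degree_power_eq[OF Delta_nz] degree_Delta power_one)
  hence "((\<lambda>x. poly (\<Delta> ^ i) x / x ^ (i * r)) \<longlongrightarrow> 1) at_infinity"
    using tendsto_poly_div_power_at_infinity[of "\<Delta> ^ i" "i * r"]
    by (simp add: degree_power_eq degree_Delta)
  hence "((\<lambda>x. (- 1) ^ i * ((poly (Polynomial.monom 1 i * c i) x / x ^ (i * r)) / (poly (\<Delta> ^ i) x / x ^ (i * r))))
      \<longlongrightarrow> (- 1) ^ i * (c_inf i / 1)) at_infinity"
    unfolding c_inf_def
    by (intro tendsto_intros tendsto_poly_div_power_at_infinity c_degree assms) auto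
  moreover have "\<forall>\<^sub>F x in at_infinity. x \<notin> insert 0 S"
  proof -
    have "bounded (insert 0 S)" using finite_S by (intro finite_imp_bounded) auto
    then obtain B where B: "\<forall>x\<in>insert 0 S. norm x \<le> B"
      unfolding bounded_iff ..
    have "x \<notin> insert 0 S" if "B + 1 \<le> norm x" for x
    proof
      assume "x \<in> insert 0 S"
      with B have "norm x \<le> B" by (rule bspec)
      with that show False by simp
    qed
    thus ?thesis unfolding eventually_at_infinity by (intro exI[of _ "B + 1"] allI impI)
  qed
  hence "\<forall>\<^sub>F x in at_infinity. (- 1) ^ i * ((poly (Polynomial.monom 1 i * c i) x / x ^ (i * r)) / (poly (\<Delta> ^ i) x / x ^ (i * r)))
    = (- x) ^ i * ratfun_eval (Fract (p i) (p 0)) x"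
  proof eventually_elim
    case (elim x)
    have "(- x) ^ i = (- 1) ^ i * x ^ i" by (rule power_minus)
    with elim show ?case by (simp add: ratfun_eval_c[OF assms] poly_monom)
  qed
  ultimately have "((\<lambda>x. (- x) ^ i * ratfun_eval (Fract (p i) (p 0)) x) \<longlongrightarrow> (- 1) ^ i * (c_inf i / 1)) at_infinity"
    by (rule Lim_transform_eventually)
  thus ?thesis unfolding indicial_coeff_inf_def by (intro tendsto_Lim) (auto simp: trivial_limit_at_infinity)
qed

end

section \<open>The adjoint operator on fractions\<close>

text \<open>Elements of \<open>k[x, 1 / D]\<close> are handled as pairs of a numerator \<open>b\<close> and an exponent \<open>e\<close>, standing
  for \<open>b / D\<^sup>e\<close>. In this notation \<open>(b / D\<^sup>e)' = dnum D e b / D\<^bsup>e+1\<^esup>\<close>, and \<open>dnums D e m b\<close> is the numerator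
  over \<open>D\<^bsup>e+m\<^esup>\<close> of the \<open>m\<close>-th derivative.\<close>

definition dnum :: "complex poly \<Rightarrow> nat \<Rightarrow> complex poly \<Rightarrow> complex poly" where
  "dnum D e b = pderiv b * D - of_nat e * b * pderiv D"

fun dnums :: "complex poly \<Rightarrow> nat \<Rightarrow> nat \<Rightarrow> complex poly \<Rightarrow> complex poly" where
  "dnums D e 0 b = b"
| "dnums D e (Suc m) b = dnums D (Suc e) m (dnum D e b)"

lemma poly_dnums_at_root:
  assumes "poly D t = 0"
  shows "poly (dnums D e m b) t =
    (- 1) ^ m * (\<Prod>l<m. of_nat (e + l)) * poly (pderiv D) t ^ m * poly b t"
  using assms
  by (induction m arbitrary: e b)
    (simp_all add: dnum_def prod.lessThan_Suc_shift add.assoc add.left_commute[of 1] del: prod.lessThan_Suc)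

text \<open>For the operator \<open>L = \<Sum>\<^sub>i (c\<^sub>i / D\<^sup>i) \<partial>\<^bsup>n-i\<^esup>\<close> the formal adjoint is
  \<open>L\<^sup>* u = \<Sum>\<^sub>i (-1)\<^bsup>n-i\<^esup> \<partial>\<^bsup>n-i\<^esup> (c\<^sub>i u / D\<^sup>i)\<close>. All terms of \<open>L\<^sup>*(b / D\<^sup>e)\<close> have the common denominator
  \<open>D\<^bsup>e+n\<^esup>\<close>, and the numerator is the following polynomial.\<close>

definition adjoint_num :: "complex poly \<Rightarrow> nat \<Rightarrow> (nat \<Rightarrow> complex poly) \<Rightarrow> nat \<Rightarrow> complex poly \<Rightarrow> complex poly" where
  "adjoint_num D n c e b = (\<Sum>i\<le>n. (- 1) ^ (n - i) * dnums D (e + i) (n - i) (c i * b))"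

lemma prod_shift_falling:
  assumes "i \<le> n" "e \<ge> 1"
  shows "(\<Prod>l<n - i. of_nat (e + i + l) :: complex) = (\<Prod>l<n - i. of_nat (e + n - 1) - of_nat l)"
proof -
  have "(\<Prod>l<n - i. of_nat (e + i + l) :: complex) = (\<Prod>l<n - i. of_nat (e + i + (n - i - Suc l)))"
    by (rule prod.nat_diff_reindex [symmetric])
  also have "\<dots> = (\<Prod>l<n - i. of_nat (e + n - 1) - of_nat l)"
  proof (rule prod.cong)
    fix l assume "l \<in> {..<n - i}"
    hence "e + i + (n - i - Suc l) = e + n - 1 - l" "l \<le> e + n - 1" using assms by auto
    thus "of_nat (e + i + (n - i - Suc l)) = (of_nat (e + n - 1) - of_nat l :: complex)"
      by (simp only: of_nat_diff)
  qed simp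
  finally show ?thesis .
qed

text \<open>At a simple root of \<open>D\<close>, differentiation multiplies the coefficient of a pole of order \<open>e\<close> by \<open>-e\<close>,
  up to the factor \<open>D'(t)\<close>. The signs cancel against those of the adjoint, and the products
  \<open>(e+i) \<cdots> (e+n-1)\<close> are falling factorials of \<open>e+n-1\<close>. So the sum on the right is the indicial
  polynomial evaluated at \<open>e+n-1\<close>, once the coefficients are identified.\<close>

lemma poly_adjoint_num_at_root:
  assumes "poly D t = 0" "poly (pderiv D) t \<noteq> 0" "e \<ge> 1"
  shows "poly (adjoint_num D n c e b) t = poly (pderiv D) t ^ n * poly b t *
    (\<Sum>i\<le>n. poly (c i) t / poly (pderiv D) t ^ i * (\<Prod>l<n - i. of_nat (e + n - 1) - of_nat l))"
proof -
  have "poly ((- 1) ^ (n - i) * dnums D (e + i) (n - i) (c i * b)) t =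
      poly (pderiv D) t ^ n * poly b t *
      (poly (c i) t / poly (pderiv D) t ^ i * (\<Prod>l<n - i. of_nat (e + n - 1) - of_nat l))"
    if "i \<le> n" for i
  proof -
    have "poly (pderiv D) t ^ n = poly (pderiv D) t ^ (n - i) * poly (pderiv D) t ^ i"
      using that by (simp flip: power_add)
    moreover have "(- 1) ^ (n - i) * (- 1) ^ (n - i) = (1::complex)"
      by (simp flip: power_add power_mult_distrib)
    ultimately show ?thesis
      using assms(2) prod_shift_falling[OF that assms(3)]
      by (simp add: poly_dnums_at_root[OF assms(1)] flip: mult.assoc)
  qed
  thus ?thesis
    unfolding adjoint_num_def poly_sum sum_distrib_left by (intro sum.cong) auto
qed

lemma dnum_degree:
  assumes "Polynomial.degree b < e * Polynomial.degree D"
  shows "Polynomial.degree (dnum D e b) < Suc e * Polynomial.degree D"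
proof -
  have "Polynomial.degree (pderiv b * D) \<le> Polynomial.degree b + Polynomial.degree D"
    by (rule order.trans[OF degree_mult_le]) (simp add: degree_pderiv)
  moreover have "Polynomial.degree (of_nat e * b * pderiv D) \<le> Polynomial.degree b + Polynomial.degree D"
    by (rule order.trans[OF degree_mult_le], rule add_mono, rule order.trans[OF degree_mult_le])
      (simp_all add: degree_pderiv)
  ultimately have "Polynomial.degree (dnum D e b) \<le> Polynomial.degree b + Polynomial.degree D"
    unfolding dnum_def by (rule degree_diff_le)
  with assms show ?thesis by simp
qed

lemma dnums_degree:
  "Polynomial.degree b < e * Polynomial.degree D \<Longrightarrow>
    Polynomial.degree (dnums D e m b) < (e + m) * Polynomial.degree D"
  by (induction m arbitrary: e b) (use dnum_degree in fastforce)+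

lemma coeff_mult_at_degree_bounds:
  fixes a b :: "complex poly"
  assumes "Polynomial.degree a \<le> i" "Polynomial.degree b \<le> j"
  shows "Polynomial.coeff (a * b) (i + j) = Polynomial.coeff a i * Polynomial.coeff b j"
proof -
  have "Polynomial.coeff (a * b) (i + j) =
      (\<Sum>l\<le>i + j. Polynomial.coeff a l * Polynomial.coeff b (i + j - l))"
    by (rule coeff_mult)
  also have "\<dots> = (\<Sum>l\<in>{i}. Polynomial.coeff a l * Polynomial.coeff b (i + j - l))"
  proof (rule sum.mono_neutral_right)
    show "\<forall>l\<in>{..i + j} - {i}. Polynomial.coeff a l * Polynomial.coeff b (i + j - l) = 0"
    proof
      fix l assume "l \<in> {..i + j} - {i}"
      hence "l > i \<or> i + j - l > j" by auto
      with assms show "Polynomial.coeff a l * Polynomial.coeff b (i + j - l) = 0"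
        by (auto simp: coeff_eq_0)
    qed
  qed auto
  finally show ?thesis by simp
qed

text \<open>This is \<open>(x\<^sup>M)' = M x\<^bsup>M-1\<^esup>\<close> for the leading term at infinity: \<open>b / D\<^sup>e\<close> grows like \<open>x\<^sup>M\<close> when \<open>b\<close> has
  degree \<open>M + e deg D\<close>. Only \<open>M = N+1 > 0\<close> occurs, which keeps all exponents natural numbers.\<close>

lemma dnum_at_infinity:
  assumes "lead_coeff D = 1" "Polynomial.degree b \<le> Suc N + e * Polynomial.degree D"
  shows "Polynomial.degree (dnum D e b) \<le> N + Suc e * Polynomial.degree D"
    and "Polynomial.coeff (dnum D e b) (N + Suc e * Polynomial.degree D) =
      of_nat (Suc N) * Polynomial.coeff b (Suc N + e * Polynomial.degree D)"
proof -
  let ?d = "Polynomial.degree D" and ?s = "N + e * Polynomial.degree D"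
  have b': "Polynomial.degree (pderiv b) \<le> ?s" using assms(2) by (simp add: degree_pderiv)
  have deg1: "Polynomial.degree (pderiv b * D) \<le> N + Suc e * ?d"
    by (rule order.trans[OF degree_mult_le]) (use b' in simp)
  have deg2: "Polynomial.degree (of_nat e * b * pderiv D) \<le> N + Suc e * ?d"
  proof (cases "?d = 0")
    case True
    then obtain h where "D = [:h:]" by (rule degree_eq_zeroE)
    thus ?thesis by (simp add: pderiv_pCons)
  next
    case False
    have "Polynomial.degree (of_nat e * b * pderiv D) \<le> Polynomial.degree b + (?d - 1)"
      by (rule order.trans[OF degree_mult_le], rule add_mono, rule order.trans[OF degree_mult_le])
        (simp_all add: degree_pderiv)
    with False assms(2) show ?thesis by simp
  qed
  show "Polynomial.degree (dnum D e b) \<le> N + Suc e * ?d"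
    unfolding dnum_def using deg1 deg2 by (rule degree_diff_le)
  have "Polynomial.coeff (pderiv b * D) (N + Suc e * ?d) = Polynomial.coeff (pderiv b * D) (?s + ?d)"
    by (simp add: ac_simps)
  also have "\<dots> = Polynomial.coeff (pderiv b) ?s"
    using coeff_mult_at_degree_bounds[OF b' order.refl, of D] assms(1) by simp
  also have "\<dots> = of_nat (Suc ?s) * Polynomial.coeff b (Suc N + e * ?d)"
    by (simp add: coeff_pderiv del: of_nat_Suc)
  finally have c1: "Polynomial.coeff (pderiv b * D) (N + Suc e * ?d) =
    of_nat (Suc ?s) * Polynomial.coeff b (Suc N + e * ?d)" .
  have c2: "Polynomial.coeff (of_nat e * b * pderiv D) (N + Suc e * ?d) =
    of_nat (e * ?d) * Polynomial.coeff b (Suc N + e * ?d)"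
  proof (cases "?d")
    case 0
    then obtain h where "D = [:h:]" by (rule degree_eq_zeroE)
    thus ?thesis by (simp add: pderiv_pCons)
  next
    case (Suc g)
    have "Polynomial.coeff (b * pderiv D) (Suc N + e * ?d + g) =
        Polynomial.coeff b (Suc N + e * ?d) * Polynomial.coeff (pderiv D) g"
      by (rule coeff_mult_at_degree_bounds) (use assms(2) Suc in \<open>simp_all add: degree_pderiv\<close>)
    moreover have "Polynomial.coeff (pderiv D) g = of_nat ?d"
      using assms(1) Suc by (simp add: coeff_pderiv del: of_nat_Suc)
    moreover have "Suc N + e * ?d + g = N + Suc e * ?d" using Suc by simp
    moreover have "of_nat e * b * pderiv D = Polynomial.smult (of_nat e) (b * pderiv D)"
      by (simp add: of_nat_poly)
    ultimately show ?thesis by (simp only: coeff_smult of_nat_mult) (simp add: mult_ac)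
  qed
  show "Polynomial.coeff (dnum D e b) (N + Suc e * ?d) =
      of_nat (Suc N) * Polynomial.coeff b (Suc N + e * ?d)"
    unfolding dnum_def coeff_diff c1 c2 by (simp add: algebra_simps)
qed

lemma dnums_at_infinity:
  assumes "lead_coeff D = 1" "Polynomial.degree b \<le> N + m + e * Polynomial.degree D"
  shows "Polynomial.degree (dnums D e m b) \<le> N + (e + m) * Polynomial.degree D \<and>
    Polynomial.coeff (dnums D e m b) (N + (e + m) * Polynomial.degree D) =
      (\<Prod>l<m. of_nat (Suc N + l)) * Polynomial.coeff b (N + m + e * Polynomial.degree D)"
  using assms(2)
proof (induction m arbitrary: e b)
  case (Suc m)
  have b: "Polynomial.degree b \<le> Suc (N + m) + e * Polynomial.degree D" using Suc.prems by simp
  note step = dnum_at_infinity[OF assms(1) b]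
  from Suc.IH[OF step(1)] step(2) show ?case by (simp add: mult_ac)
qed simp

text \<open>\<open>L\<^sup>* x\<^bsup>m+n\<^esup>\<close> grows like \<open>x\<^sup>m\<close>. Its leading coefficient is, up to sign, the indicial polynomial at
  infinity evaluated at \<open>m+1\<close>, as the products are rising factorials of \<open>m+1\<close>.\<close>

lemma adjoint_num_at_infinity:
  assumes D: "lead_coeff D = 1"
    and c: "\<And>i. i \<le> n \<Longrightarrow> Polynomial.degree (Polynomial.monom 1 i * c i) \<le> i * Polynomial.degree D"
  shows "Polynomial.degree (adjoint_num D n c 0 (Polynomial.monom 1 (m + n))) \<le> m + n * Polynomial.degree D"
    and "Polynomial.coeff (adjoint_num D n c 0 (Polynomial.monom 1 (m + n))) (m + n * Polynomial.degree D) =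
      (\<Sum>i\<le>n. (- 1) ^ (n - i) * Polynomial.coeff (Polynomial.monom 1 i * c i) (i * Polynomial.degree D) *
        (\<Prod>l<n - i. of_nat (Suc m + l)))"
proof -
  let ?d = "Polynomial.degree D"
  let ?g = "\<lambda>i. (- 1) ^ (n - i) * dnums D (0 + i) (n - i) (c i * Polynomial.monom 1 (m + n))"
  have main: "Polynomial.degree (?g i) \<le> m + n * ?d \<and> Polynomial.coeff (?g i) (m + n * ?d) =
      (- 1) ^ (n - i) * Polynomial.coeff (Polynomial.monom 1 i * c i) (i * ?d) * (\<Prod>l<n - i. of_nat (Suc m + l))"
    if i: "i \<le> n" for i
  proof -
    let ?b = "c i * Polynomial.monom 1 (m + n)"
    have "Polynomial.monom 1 i * Polynomial.monom 1 (m + (n - i)) = (Polynomial.monom 1 (m + n) :: complex poly)"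
      using i by (simp add: mult_monom)
    hence b: "?b = Polynomial.monom 1 (m + (n - i)) * (Polynomial.monom 1 i * c i)"
      by (metis mult.commute mult.left_commute)
    have "Polynomial.degree ?b \<le> (m + (n - i)) + i * ?d"
      unfolding b by (rule order.trans[OF degree_mult_le], rule add_mono)
        (simp_all add: degree_monom_le c i)
    moreover have "Polynomial.coeff ?b (m + (n - i) + i * ?d) =
        Polynomial.coeff (Polynomial.monom 1 i * c i) (i * ?d)"
      unfolding b by (subst coeff_mult_at_degree_bounds) (simp_all add: degree_monom_le c i)
    ultimately have "Polynomial.degree (dnums D i (n - i) ?b) \<le> m + n * ?d \<and>
      Polynomial.coeff (dnums D i (n - i) ?b) (m + n * ?d) =
      (\<Prod>l<n - i. of_nat (Suc m + l)) * Polynomial.coeff (Polynomial.monom 1 i * c i) (i * ?d)"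
      using dnums_at_infinity[OF D, of ?b m "n - i" i] i by simp
    thus ?thesis
      by (cases "even (n - i)") (simp_all add: mult_ac)
  qed
  show "Polynomial.degree (adjoint_num D n c 0 (Polynomial.monom 1 (m + n))) \<le> m + n * ?d"
    unfolding adjoint_num_def using main by (intro degree_sum_le) auto
  show "Polynomial.coeff (adjoint_num D n c 0 (Polynomial.monom 1 (m + n))) (m + n * ?d) =
      (\<Sum>i\<le>n. (- 1) ^ (n - i) * Polynomial.coeff (Polynomial.monom 1 i * c i) (i * ?d) *
        (\<Prod>l<n - i. of_nat (Suc m + l)))"
    unfolding adjoint_num_def coeff_sum using main by (intro sum.cong) auto
qed

lemma rsquarefree_dvdI:
  fixes D a :: "complex poly"
  assumes "rsquarefree D" "\<And>t. poly D t = 0 \<Longrightarrow> poly a t = 0"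
  shows "D dvd a"
proof (cases "a = 0")
  case False
  show ?thesis
  proof (rule complex_poly_dvd_if_order_le)
    fix t
    show "Polynomial.order t D \<le> Polynomial.order t a"
      using assms False unfolding rsquarefree_def
      by (metis le_numeral_extra(4) less_one not_le order_root zero_le)
  qed (use assms(1) in \<open>simp add: rsquarefree_def\<close>)
qed simp

section \<open>The forms attached to a solution\<close>

context fuchsian_operator
begin

lemma dnum_P: "a \<in> P \<Longrightarrow> dnum \<Delta> e a \<in> P"
proof -
  assume a: "a \<in> P"
  have "(of_nat e :: complex poly) \<in> P" by (induction e) (auto intro: P_add)
  thus ?thesis unfolding dnum_def by (intro P_diff P_mult P_pderiv Delta_P a)
qed

end

locale fuchsian_solution = fuchsian_operator +
  fixes U :: "complex set" and f :: "complex \<Rightarrow> complex"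
  assumes openU: "open U" and U_S: "U \<inter> S = {}"
    and holf: "f holomorphic_on U"
    and sol: "x \<in> U \<Longrightarrow> diffop n p f x = 0"
begin

text \<open>Every rational function over \<open>k\<close> with poles only in \<open>S\<close> is a quotient \<open>a / \<Delta>\<^sup>e\<close> with \<open>a \<in> k[x]\<close>, so
  these are the generators of the twisted forms. The pair \<open>(a, e)\<close> is not unique: see \<open>\<Phi>_cancel\<close>.\<close>

definition \<Phi> :: "complex poly \<Rightarrow> nat \<Rightarrow> nat \<Rightarrow> complex \<Rightarrow> complex" where
  "\<Phi> a e i = form_on U (\<lambda>x. poly a x / poly \<Delta> x ^ e * (deriv ^^ i) f x)"

lemma \<Phi>_apply: "\<Phi> a e i x = (if x \<in> U then poly a x / poly \<Delta> x ^ e * (deriv ^^ i) f x else 0)"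
  by (simp add: \<Phi>_def form_on_def)

lemma notin_S: "x \<in> U \<Longrightarrow> x \<notin> S"
  using U_S by blast

lemma Delta_nz_U: "x \<in> U \<Longrightarrow> poly \<Delta> x \<noteq> 0"
  by (simp add: notin_S)

lemma hol_deriv_f: "(deriv ^^ i) f holomorphic_on U"
  by (intro holomorphic_higher_deriv holf openU)

lemma \<Phi>_carrier: "\<Phi> a e i \<in> carrier (holo_forms U)"
  unfolding \<Phi>_def holo_forms_def using Delta_nz_U
  by (auto intro!: exI[of _ "\<lambda>x. poly a x / poly \<Delta> x ^ e * (deriv ^^ i) f x"] holomorphic_intros hol_deriv_f)

lemma \<Phi>_add: "\<Phi> (a + b) e i x = \<Phi> a e i x + \<Phi> b e i x"
  and \<Phi>_diff: "\<Phi> (a - b) e i x = \<Phi> a e i x - \<Phi> b e i x"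
  and \<Phi>_smult: "\<Phi> (Polynomial.smult s a) e i x = s * \<Phi> a e i x"
  and \<Phi>_0: "\<Phi> 0 e i x = 0"
  by (simp_all add: \<Phi>_apply add_divide_distrib diff_divide_distrib algebra_simps)

lemma \<Phi>_sum: "\<Phi> (sum g A) e i x = (\<Sum>j\<in>A. \<Phi> (g j) e i x)"
  by (induction A rule: infinite_finite_induct) (simp_all add: \<Phi>_0 \<Phi>_add)

lemma \<Phi>_cancel: "\<Phi> (\<Delta> ^ m * a) (e + m) i = \<Phi> a e i"
  using Delta_nz_U by (auto simp: \<Phi>_apply power_add)

lemma ratfun_form:
  assumes "\<And>x. x \<notin> S \<Longrightarrow> ratfun_eval q x = poly a x / poly \<Delta> x ^ e"
  shows "form_on U (\<lambda>x. ratfun_eval q x * (deriv ^^ i) f x) = \<Phi> a e i"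
proof
  fix x show "form_on U (\<lambda>x. ratfun_eval q x * (deriv ^^ i) f x) x = \<Phi> a e i x"
    using assms[of x] notin_S[of x] by (simp add: form_on_def \<Phi>_apply)
qed

text \<open>The product rule turns the generators of the exact forms into the relations that allow
  integration by parts.\<close>

lemma ratfun_form_deriv:
  assumes "\<And>x. x \<notin> S \<Longrightarrow> ratfun_eval q x = poly a x / poly \<Delta> x ^ e"
  shows "form_on U (deriv (\<lambda>x. ratfun_eval q x * (deriv ^^ i) f x)) =
    (\<lambda>x. \<Phi> (dnum \<Delta> e a) (Suc e) i x + \<Phi> a e (Suc i) x)"
proof
  fix x
  show "form_on U (deriv (\<lambda>x. ratfun_eval q x * (deriv ^^ i) f x)) x =
    \<Phi> (dnum \<Delta> e a) (Suc e) i x + \<Phi> a e (Suc i) x"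
  proof (cases "x \<in> U")
    case True
    let ?F = "\<lambda>x. poly a x / poly \<Delta> x ^ e * (deriv ^^ i) f x"
    let ?d = "poly \<Delta> x"
    have nz: "?d \<noteq> 0" using True by (rule Delta_nz_U)
    have pw: "of_nat e * ?d ^ (e - 1) * ?d = of_nat e * ?d ^ e" by (cases e) simp_all
    have 1: "((\<lambda>x. poly a x) has_field_derivative poly (pderiv a) x) (at x)" by (rule poly_DERIV)
    have 2: "((\<lambda>x. poly \<Delta> x ^ e) has_field_derivative of_nat e * ?d ^ (e - 1) * poly (pderiv \<Delta>) x) (at x)"
      by (rule derivative_eq_intros poly_DERIV refl)+ (simp add: mult_ac)
    have 3: "((deriv ^^ i) f has_field_derivative (deriv ^^ Suc i) f x) (at x)"
      using holomorphic_derivI[OF hol_deriv_f openU True] by simp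
    have "(?F has_field_derivative
       ((poly (pderiv a) x * ?d ^ e - poly a x * (of_nat e * ?d ^ (e - 1) * poly (pderiv \<Delta>) x)) / (?d ^ e * ?d ^ e))
         * (deriv ^^ i) f x + (deriv ^^ Suc i) f x * (poly a x / ?d ^ e)) (at x)"
      by (rule DERIV_mult[OF DERIV_divide[OF 1 2] 3]) (use nz in simp)
    also have "(poly (pderiv a) x * ?d ^ e - poly a x * (of_nat e * ?d ^ (e - 1) * poly (pderiv \<Delta>) x)) / (?d ^ e * ?d ^ e)
      = poly (dnum \<Delta> e a) x / ?d ^ Suc e"
    proof -
      have "(poly (pderiv a) x * ?d ^ e - poly a x * (of_nat e * ?d ^ (e - 1) * poly (pderiv \<Delta>) x)) * ?d
        = poly (pderiv a) x * ?d ^ e * ?d - poly a x * poly (pderiv \<Delta>) x * (of_nat e * ?d ^ (e - 1) * ?d)"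
        by (simp add: algebra_simps)
      also have "\<dots> = poly (dnum \<Delta> e a) x * ?d ^ e"
        unfolding pw by (simp add: dnum_def algebra_simps)
      finally show ?thesis using nz by (simp add: frac_eq_eq mult_ac)
    qed
    finally have D: "(?F has_field_derivative
      poly (dnum \<Delta> e a) x / ?d ^ Suc e * (deriv ^^ i) f x + (deriv ^^ Suc i) f x * (poly a x / ?d ^ e)) (at x)" .
    have "((\<lambda>x. ratfun_eval q x * (deriv ^^ i) f x) has_field_derivative
      poly (dnum \<Delta> e a) x / ?d ^ Suc e * (deriv ^^ i) f x + (deriv ^^ Suc i) f x * (poly a x / ?d ^ e)) (at x)"
      by (rule has_field_derivative_transform_within_open[OF D openU True]) (simp add: assms notin_S)
    hence "deriv (\<lambda>x. ratfun_eval q x * (deriv ^^ i) f x) x =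
      poly (dnum \<Delta> e a) x / ?d ^ Suc e * (deriv ^^ i) f x + (deriv ^^ Suc i) f x * (poly a x / ?d ^ e)"
      by (rule DERIV_imp_deriv)
    with True show ?thesis by (simp add: form_on_def \<Phi>_apply mult_ac)
  qed (simp add: form_on_def \<Phi>_apply)
qed

text \<open>Division by \<open>p\<^sub>0\<close> is possible except at its roots, which may lie in \<open>U\<close> when they are common
  to all coefficients. There the monic equation follows by continuity.\<close>

lemma monic_equation:
  assumes "x \<in> U"
  shows "(\<Sum>i\<le>n. poly (c i) x / poly \<Delta> x ^ i * (deriv ^^ (n - i)) f x) = 0"
proof -
  let ?g = "\<lambda>x. \<Sum>i\<le>n. poly (c i) x / poly \<Delta> x ^ i * (deriv ^^ (n - i)) f x"
  have zero: "?g y = 0" if y: "y \<in> U" "poly (p 0) y \<noteq> 0" for y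
  proof -
    have "poly (p 0) y * ?g y = diffop n p f y"
      unfolding diffop_def sum_distrib_left
    proof (rule sum.cong)
      fix i assume "i \<in> {..n}"
      hence "poly (p i * \<Delta> ^ i) y = poly (c i * p 0) y" by (subst c_eq) auto
      hence "poly (p i) y = poly (c i) y * poly (p 0) y / poly \<Delta> y ^ i"
        using Delta_nz_U[OF y(1)] by (simp add: eq_divide_eq)
      thus "poly (p 0) y * (poly (c i) y / poly \<Delta> y ^ i * (deriv ^^ (n - i)) f y) =
        poly (p i) y * (deriv ^^ (n - i)) f y" by simp
    qed simp
    with y sol show ?thesis by simp
  qed
  have "?g holomorphic_on U"
    using Delta_nz_U by (auto intro!: holomorphic_intros hol_deriv_f)
  hence "continuous_on U ?g" by (rule holomorphic_on_imp_continuous_on)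
  hence "(?g \<longlongrightarrow> ?g x) (at x)"
    using assms openU by (metis (no_types, lifting) at_within_open continuous_on_def)
  moreover have "(?g \<longlongrightarrow> 0) (at x)"
  proof (rule Lim_transform_eventually)
    show "((\<lambda>_. 0) \<longlongrightarrow> 0) (at x)" by (rule tendsto_const)
    let ?V = "U - ({y. poly (p 0) y = 0} - {x})"
    have "open ?V" using poly_roots_finite[OF p0]
      by (intro open_Diff openU finite_imp_closed) simp
    hence "\<forall>\<^sub>F y in at x. y \<in> U \<and> poly (p 0) y \<noteq> 0"
      unfolding eventually_at_topological using assms by (intro exI[of _ ?V]) auto
    thus "\<forall>\<^sub>F y in at x. 0 = ?g y" 
    proof eventually_elim
      case (elim y)
      thus ?case using zero[of y] by simp
    qed
  qed
  ultimately show ?thesis by (rule tendsto_unique[OF at_neq_bot])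
qed

lemma \<Phi>_equation: "(\<Sum>i\<le>n. \<Phi> (c i * b) (e + i) (n - i) x) = 0"
proof (cases "x \<in> U")
  case True
  have "(\<Sum>i\<le>n. \<Phi> (c i * b) (e + i) (n - i) x) = poly b x / poly \<Delta> x ^ e *
      (\<Sum>i\<le>n. poly (c i) x / poly \<Delta> x ^ i * (deriv ^^ (n - i)) f x)"
    using True unfolding sum_distrib_left
    by (intro sum.cong) (auto simp: \<Phi>_apply power_add)
  thus ?thesis using monic_equation[OF True] by simp
qed (simp add: \<Phi>_apply)

end

section \<open>Consequences of the conditions on the exponents\<close>

locale exponent_conditions = fuchsian_operator +
  assumes exp_finite: "m \<ge> int n \<Longrightarrow> of_int m \<notin> exponents n p t"
    and exp_inf: "m > 0 \<Longrightarrow> of_int m \<notin> exponents_inf n p"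
begin

abbreviation adj :: "nat \<Rightarrow> complex poly \<Rightarrow> complex poly" where
  "adj \<equiv> adjoint_num \<Delta> n c"

lemma Delta_rsquarefree: "rsquarefree \<Delta>"
  unfolding rsquarefree_roots
proof safe
  fix t assume t: "poly \<Delta> t = 0" and t': "poly (pderiv \<Delta>) t = 0"
  from t have "t \<in> S" by simp
  then show False by (rule Delta_factor) (use t' in auto)
qed

lemma pderiv_Delta_nz: "t \<in> S \<Longrightarrow> poly (pderiv \<Delta>) t \<noteq> 0"
  using Delta_rsquarefree unfolding rsquarefree_roots by auto

lemma adj_at_singularity:
  assumes "t \<in> S" "e \<ge> 1"
  shows "poly (adj e b) t = poly (pderiv \<Delta>) t ^ n * poly b t *
    poly (indicial_poly n p t) (of_nat (e + n - 1))"
proof -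
  let ?X = "of_nat (e + n - 1) :: complex"
  have "{..n} = insert 0 {1..n}" by auto
  hence "(\<Sum>i\<le>n. poly (c i) t / poly (pderiv \<Delta>) t ^ i * (\<Prod>l<n - i. ?X - of_nat l)) =
     poly (indicial_poly n p t) ?X"
    using assms(1) by (simp add: indicial_poly_def poly_prod poly_sum c_0 indicial_coeff_eq)
  thus ?thesis
    by (subst poly_adjoint_num_at_root) (use assms pderiv_Delta_nz in simp_all)
qed

text \<open>Since \<open>e + n - 1 \<ge> n\<close>, the leading coefficient of \<open>L\<^sup>*(b / \<Delta>\<^sup>e)\<close> at \<open>t\<close> is a nonzero multiple of \<open>b(t)\<close>,
  and the factor is the value at \<open>t\<close> of a polynomial over \<open>k\<close>, namely the numerator for \<open>b = 1\<close>.\<close>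

lemma adj_1_nz:
  assumes "t \<in> S" "e \<ge> 1"
  shows "poly (adj e 1) t \<noteq> 0"
proof -
  have "of_int (int (e + n - 1)) \<notin> exponents n p t"
    by (rule exp_finite) (use assms(2) in simp)
  thus ?thesis
    using assms pderiv_Delta_nz by (simp add: adj_at_singularity exponents_def)
qed

text \<open>As \<open>m + 1 > 0\<close> is not an exponent at infinity, the bound on the degree of the numerator of
  \<open>L\<^sup>* x\<^bsup>m+n\<^esup>\<close> is attained.\<close>

lemma adj_monom:
  "Polynomial.degree (adj 0 (Polynomial.monom 1 (m + n))) = m + n * r"
  "adj 0 (Polynomial.monom 1 (m + n)) \<noteq> 0"
proof -
  let ?a = "adj 0 (Polynomial.monom 1 (m + n))"
  let ?X = "of_nat (Suc m) :: complex"
  note inf = adjoint_num_at_infinity[OF lead_coeff_Delta, unfolded degree_Delta, OF c_degree, of n m]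
  have "Polynomial.coeff ?a (m + n * r) =
      (\<Sum>i\<le>n. (- 1) ^ (n - i) * c_inf i * (\<Prod>l<n - i. of_nat (Suc m + l)))"
    using inf(2) by (simp add: c_inf_def)
  also have "\<dots> = (- 1) ^ n * (\<Sum>i\<le>n. (- 1) ^ i * c_inf i * (\<Prod>l<n - i. ?X + of_nat l))"
    unfolding sum_distrib_left
  proof (rule sum.cong)
    fix i assume i: "i \<in> {..n}"
    have "(- 1) ^ n * (- 1) ^ i = ((- 1) ^ (n - i) :: complex)"
      using i by (auto simp: minus_one_power_iff)
    thus "(- 1) ^ (n - i) * c_inf i * (\<Prod>l<n - i. of_nat (Suc m + l)) =
        (- 1) ^ n * ((- 1) ^ i * c_inf i * (\<Prod>l<n - i. ?X + of_nat l))"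
      by (simp add: add.assoc flip: mult.assoc)
  qed simp
  also have "(\<Sum>i\<le>n. (- 1) ^ i * c_inf i * (\<Prod>l<n - i. ?X + of_nat l)) =
      poly (indicial_poly_inf n p) ?X"
  proof -
    have "{..n} = insert 0 {1..n}" by auto
    thus ?thesis
      by (simp add: indicial_poly_inf_def poly_prod poly_sum indicial_coeff_inf_eq c_inf_def c_0 add.commute)
  qed
  finally have "Polynomial.coeff ?a (m + n * r) = (- 1) ^ n * poly (indicial_poly_inf n p) ?X" .
  moreover have "of_int (int (Suc m)) \<notin> exponents_inf n p" by (rule exp_inf) simp
  ultimately have nz: "Polynomial.coeff ?a (m + n * r) \<noteq> 0"
    by (simp add: exponents_inf_def)
  thus "?a \<noteq> 0" by auto
  from nz have "m + n * r \<le> Polynomial.degree ?a" by (rule le_degree)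
  with inf(1) show "Polynomial.degree ?a = m + n * r" by simp
qed

lemma dnums_P: "a \<in> P \<Longrightarrow> dnums \<Delta> e m a \<in> P"
  by (induction m arbitrary: e a) (auto intro: dnum_P)

lemma adj_P: "a \<in> P \<Longrightarrow> adj e a \<in> P"
  unfolding adjoint_num_def
  by (intro P_sum P_mult P_power P_uminus P_1 dnums_P c_P) auto

text \<open>The conditions on the leading coefficients at all roots of \<open>\<Delta>\<close> form one congruence modulo \<open>\<Delta>\<close>, which can be solved
  in \<open>k[x]\<close>.\<close>

lemma residue_interpolation:
  assumes "w \<in> P" "a \<in> P" "\<And>t. t \<in> S \<Longrightarrow> poly w t \<noteq> 0"
  obtains b where "b \<in> P" "b = 0 \<or> Polynomial.degree b < r"
    "\<And>t. t \<in> S \<Longrightarrow> poly w t * poly b t = poly a t"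
proof -
  obtain u where u: "u \<in> P" "\<Delta> dvd 1 - u * w"
    by (rule P_inverse_mod[OF assms(1) Delta_P]) (use assms(3) in auto)
  show ?thesis
  proof
    show "(u * a) mod \<Delta> \<in> P" by (intro P_mod P_mult u assms Delta_P)
    show "(u * a) mod \<Delta> = 0 \<or> Polynomial.degree ((u * a) mod \<Delta>) < r"
      using degree_mod_less[of \<Delta> "u * a"] by (simp add: degree_Delta)
    fix t assume t: "t \<in> S"
    have "poly ((u * a) mod \<Delta>) t = poly (u * a) t"
      by (rule poly_mod) (use t in simp)
    moreover have "poly (1 - u * w) t = 0"
      using u(2) t by (meson Delta_root_iff dvd_trans poly_eq_0_iff_dvd)
    ultimately show "poly w t * poly ((u * a) mod \<Delta>) t = poly a t"
      by (simp add: algebra_simps)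
  qed
qed

lemma divide_by_Delta:
  assumes "a \<in> P" "\<And>t. t \<in> S \<Longrightarrow> poly a t = 0"
  obtains a' where "a' \<in> P" "a = \<Delta> * a'"
proof
  show "a div \<Delta> \<in> P" by (intro P_div assms Delta_P)
  have "\<Delta> dvd a" by (rule rsquarefree_dvdI[OF Delta_rsquarefree]) (use assms in auto)
  thus "a = \<Delta> * (a div \<Delta>)" by simp
qed

end

section \<open>Reduction modulo exact forms\<close>

text \<open>\<open>Q\<close> is an arbitrary \<open>k\<close>-subspace that contains the exact forms and the proposed generators.
  Membership of a difference in \<open>Q\<close> serves as the congruence in which forms are reduced, so that the
  argument needs neither quotients nor explicit linear combinations.\<close>

locale de_rham_reduction = fuchsian_solution + exponent_conditions +
  fixes Q :: "(complex \<Rightarrow> complex) set"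
  assumes Q_0: "(\<lambda>x. 0) \<in> Q"
    and Q_add: "g \<in> Q \<Longrightarrow> h \<in> Q \<Longrightarrow> (\<lambda>x. g x + h x) \<in> Q"
    and Q_smult: "s \<in> k \<Longrightarrow> g \<in> Q \<Longrightarrow> (\<lambda>x. s * g x) \<in> Q"
    and Q_exact: "a \<in> P \<Longrightarrow> i < n \<Longrightarrow>
      (\<lambda>x. \<Phi> (dnum \<Delta> e a) (Suc e) i x + \<Phi> a e (Suc i) x) \<in> Q"
    and Q_gen: "j < r \<Longrightarrow> i < n \<Longrightarrow> \<Phi> (Polynomial.monom 1 j) 1 i \<in> Q"
begin

lemma Q_diff: "g \<in> Q \<Longrightarrow> h \<in> Q \<Longrightarrow> (\<lambda>x. g x - h x) \<in> Q"
  using Q_add[of g "\<lambda>x. - 1 * h x"] Q_smult[of "- 1" h] uminus_mem[of 1] by simp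

lemma sign_mem: "(- 1) ^ m \<in> k"
  by (induction m) (auto intro: uminus_mem)

lemma Q_sum: "(\<And>i. i \<in> A \<Longrightarrow> g i \<in> Q) \<Longrightarrow> (\<lambda>x. \<Sum>i\<in>A. g i x) \<in> Q"
  by (induction A rule: infinite_finite_induct) (auto intro: Q_0 Q_add)

lemma integrate_by_parts:
  "a \<in> P \<Longrightarrow> m \<le> n \<Longrightarrow>
    (\<lambda>x. \<Phi> a e m x - (- 1) ^ m * \<Phi> (dnums \<Delta> e m a) (e + m) 0 x) \<in> Q"
proof (induction m arbitrary: a e)
  case 0
  thus ?case using Q_0 by simp
next
  case (Suc m)
  have "(\<lambda>x. (\<Phi> (dnum \<Delta> e a) (Suc e) m x + \<Phi> a e (Suc m) x) -
    (\<Phi> (dnum \<Delta> e a) (Suc e) m x - (- 1) ^ m * \<Phi> (dnums \<Delta> (Suc e) m (dnum \<Delta> e a)) (Suc e + m) 0 x)) \<in> Q"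
    using Suc.prems by (intro Q_diff Q_exact Suc.IH dnum_P) auto
  thus ?case by simp
qed

text \<open>Integrating \<open>u L f = 0\<close> by parts moves all derivatives to \<open>u = b / \<Delta>\<^sup>e\<close>, so \<open>f L\<^sup>* u dx\<close> is exact.\<close>

lemma adj_in_Q:
  assumes "b \<in> P"
  shows "\<Phi> (adj e b) (e + n) 0 \<in> Q"
proof -
  have sgn: "\<Phi> ((- 1) ^ m * q) e' 0 x = (- 1) ^ m * \<Phi> q e' 0 x" for m q e' x
    by (simp add: \<Phi>_apply)
  have "(\<lambda>x. \<Sum>i\<le>n. \<Phi> (c i * b) (e + i) (n - i) x -
      (- 1) ^ (n - i) * \<Phi> (dnums \<Delta> (e + i) (n - i) (c i * b)) (e + i + (n - i)) 0 x) \<in> Q"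
    by (intro Q_sum integrate_by_parts P_mult c_P assms) auto
  also have "(\<lambda>x. \<Sum>i\<le>n. \<Phi> (c i * b) (e + i) (n - i) x -
      (- 1) ^ (n - i) * \<Phi> (dnums \<Delta> (e + i) (n - i) (c i * b)) (e + i + (n - i)) 0 x) =
      (\<lambda>x. - 1 * \<Phi> (adj e b) (e + n) 0 x)"
    by (simp add: sum_subtractf \<Phi>_equation adjoint_num_def \<Phi>_sum sgn)
  finally have "(\<lambda>x. - 1 * (- 1 * \<Phi> (adj e b) (e + n) 0 x)) \<in> Q"
    by (rule Q_smult[OF uminus_mem[OF one_mem]])
  thus ?thesis by simp
qed

lemma \<Phi>_Delta_cancel: "\<Phi> (\<Delta> * a) (Suc e) i = \<Phi> a e i"
  using \<Phi>_cancel[of 1 a e i] by simp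

lemma \<Phi>_split:
  assumes "\<Phi> b e i \<in> Q" "\<Phi> (a - b) e i \<in> Q"
  shows "\<Phi> a e i \<in> Q"
  using Q_add[OF assms] by (simp add: \<Phi>_diff)

text \<open>For \<open>e = m + 1 \<le> n\<close> and \<open>b \<in> k[x]\<close>, the form \<open>b f\<^bsup>(m)\<^esup> dx / \<Delta>\<close> with \<open>deg b < r\<close> is a combination of generators and
  congruent up to sign to \<open>(b / \<Delta>)\<^bsup>(m)\<^esup> f dx\<close>. At each singularity \<open>t\<close> the coefficient of the pole
  of order \<open>e\<close> of \<open>(b / \<Delta>)\<^bsup>(m)\<^esup>\<close> is \<open>b(t)\<close> times a nonzero factor that does not depend on \<open>b\<close>. A suitable \<open>b\<close> thus lowers the pole order by
  one everywhere, and the bound on the degree survives; at order \<open>0\<close> it leaves only \<open>0\<close>.\<close>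

lemma low_degree_in_Q:
  "e \<le> n \<Longrightarrow> a \<in> P \<Longrightarrow> a = 0 \<or> Polynomial.degree a < e * r \<Longrightarrow> \<Phi> a e 0 \<in> Q"
proof (induction e arbitrary: a)
  case 0
  hence "\<Phi> a 0 0 = (\<lambda>x. 0)" by (auto simp: \<Phi>_0)
  thus ?case using Q_0 by simp
next
  case (Suc e)
  show ?case
  proof (cases "a = 0")
    case True
    hence "\<Phi> a (Suc e) 0 = (\<lambda>x. 0)" by (auto simp: \<Phi>_0)
    thus ?thesis using Q_0 by simp
  next
    case False
    with Suc.prems have deg: "Polynomial.degree a < Suc e * r" by simp
    hence r: "r > 0" by (cases "r = 0") auto
    \<comment> \<open>At the singularities the numerator of \<open>(b / \<Delta>)\<^bsup>(e)\<^esup>\<close> is \<open>w b\<close>, with \<open>w\<close> the one for \<open>b = 1\<close>.\<close>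
    let ?w = "dnums \<Delta> 1 e 1"
    have w: "poly (dnums \<Delta> 1 e b) t = poly ?w t * poly b t" if "t \<in> S" for b t
      using that by (simp add: poly_dnums_at_root)
    have wnz: "poly ?w t \<noteq> 0" if "t \<in> S" for t
    proof -
      have "(of_nat (1 + l) :: complex) \<noteq> 0" for l by (simp only: of_nat_eq_0_iff)
      thus ?thesis using that pderiv_Delta_nz[OF that]
        by (subst poly_dnums_at_root) (simp_all del: of_nat_add)
    qed
    obtain b where b: "b \<in> P" "b = 0 \<or> Polynomial.degree b < r"
      "\<And>t. t \<in> S \<Longrightarrow> poly ?w t * poly b t = poly a t"
      by (rule residue_interpolation[OF dnums_P[OF P_1] Suc.prems(2)]) (rule wnz, assumption, rule that)
    from b(2) r have db: "Polynomial.degree b < r" by auto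
    let ?B = "dnums \<Delta> 1 e b"
    have BP: "?B \<in> P" by (rule dnums_P[OF b(1)])
    obtain a' where a': "a' \<in> P" "a - ?B = \<Delta> * a'"
    proof (rule divide_by_Delta)
      show "a - ?B \<in> P" by (rule P_diff[OF Suc.prems(2) BP])
      show "poly (a - ?B) t = 0" if "t \<in> S" for t
        using w[OF that, of b] b(3)[OF that] by simp
    qed (rule that)
    have degB: "Polynomial.degree ?B < Suc e * r"
      using dnums_degree[of b 1 \<Delta> e] db by (simp add: degree_Delta)
    have "a' = 0 \<or> Polynomial.degree a' < e * r"
    proof (cases "a' = 0")
      case False
      have "Polynomial.degree (\<Delta> * a') < Suc e * r"
        unfolding a'(2) [symmetric] using deg degB by (rule degree_diff_less)
      thus ?thesis using False by (simp add: degree_mult_eq degree_Delta)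
    qed simp
    hence "\<Phi> a' e 0 \<in> Q" using Suc.IH Suc.prems a' by simp
    hence diff: "\<Phi> (a - ?B) (Suc e) 0 \<in> Q" by (simp only: a'(2) \<Phi>_Delta_cancel)
    have "b = (\<Sum>j<r. Polynomial.smult (Polynomial.coeff b j) (Polynomial.monom 1 j))"
    proof -
      have "b = (\<Sum>j\<le>r - 1. Polynomial.monom (Polynomial.coeff b j) j)"
        by (rule poly_as_sum_of_monoms' [symmetric]) (use db in simp)
      also have "{..r - 1} = {..<r}" using r by auto
      finally show ?thesis by (simp add: smult_monom)
    qed
    hence "\<Phi> b 1 e = \<Phi> (\<Sum>j<r. Polynomial.smult (Polynomial.coeff b j) (Polynomial.monom 1 j)) 1 e"
      by (rule arg_cong)
    also have "\<dots> = (\<lambda>x. \<Sum>j<r. Polynomial.coeff b j * \<Phi> (Polynomial.monom 1 j) 1 e x)"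
      by (rule ext) (simp add: \<Phi>_sum \<Phi>_smult)
    also have "\<dots> \<in> Q"
      using Suc.prems by (intro Q_sum Q_smult Q_gen coeff_mem b) auto
    finally have bQ: "\<Phi> b 1 e \<in> Q" .
    have "(\<lambda>x. \<Phi> b 1 e x - (\<Phi> b 1 e x - (- 1) ^ e * \<Phi> ?B (1 + e) 0 x)) \<in> Q"
      using Suc.prems b by (intro Q_diff bQ integrate_by_parts) auto
    hence "(\<lambda>x. (- 1) ^ e * \<Phi> ?B (Suc e) 0 x) \<in> Q" by simp
    from Q_smult[OF sign_mem[of e] this]
    have "(\<lambda>x. (- 1) ^ e * ((- 1) ^ e * \<Phi> ?B (Suc e) 0 x)) \<in> Q" .
    also have "(\<lambda>x. (- 1) ^ e * ((- 1) ^ e * \<Phi> ?B (Suc e) 0 x)) = \<Phi> ?B (Suc e) 0"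
      by (simp flip: mult.assoc power_add)
    finally show ?thesis using diff by (rule \<Phi>_split)
  qed
qed

text \<open>Subtracting multiples of \<open>L\<^sup>* x\<^bsup>m+n\<^esup>\<close> lowers the pole at infinity, without raising those at finite
  points above \<open>n\<close>.\<close>

lemma pole_order_n_in_Q: "a \<in> P \<Longrightarrow> \<Phi> a n 0 \<in> Q"
proof (induction "Polynomial.degree a" arbitrary: a rule: less_induct)
  case less
  show ?case
  proof (cases "a = 0 \<or> Polynomial.degree a < n * r")
    case True
    thus ?thesis using less.prems by (intro low_degree_in_Q) auto
  next
    case False
    define m where "m = Polynomial.degree a - n * r"
    have da: "Polynomial.degree a = m + n * r" using False by (simp add: m_def)
    let ?A = "adj 0 (Polynomial.monom 1 (m + n))"
    let ?s = "lead_coeff a / lead_coeff ?A"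
    let ?B = "Polynomial.smult ?s ?A"
    have AP: "?A \<in> P" by (intro adj_P P_monom one_mem)
    have sk: "?s \<in> k" by (intro divide_mem coeff_mem less.prems AP)
    have BP: "?B \<in> P" by (intro P_smult sk AP)
    have "\<Phi> ?A n 0 \<in> Q" using adj_in_Q[OF P_monom[OF one_mem], of 0] by simp
    from Q_smult[OF sk this] have BQ: "\<Phi> ?B n 0 \<in> Q"
      unfolding \<Phi>_smult [symmetric] .
    have "Polynomial.degree ?B \<le> Polynomial.degree a"
      using degree_smult_le[of ?s ?A] by (simp add: adj_monom da)
    hence le: "Polynomial.degree (a - ?B) \<le> Polynomial.degree a" by (intro degree_diff_le) auto
    have cf: "Polynomial.coeff (a - ?B) (Polynomial.degree a) = 0"
    proof -
      have "Polynomial.coeff ?A (Polynomial.degree a) = lead_coeff ?A" by (simp only: adj_monom(1) da)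
      moreover have "lead_coeff ?A \<noteq> 0" using adj_monom(2) by simp
      ultimately show ?thesis by simp
    qed
    show ?thesis
    proof (cases "a - ?B = 0")
      case True
      hence "a = ?B" by (simp only: right_minus_eq)
      with BQ show ?thesis by (simp only:)
    next
      case nz: False
      with le cf have "Polynomial.degree (a - ?B) < Polynomial.degree a"
        by (metis le_neq_implies_less leading_coeff_0_iff)
      from less.hyps[OF this P_diff[OF less.prems BP]]
      show ?thesis by (rule \<Phi>_split[OF BQ])
    qed
  qed
qed

text \<open>A numerator \<open>b\<close> with the right values at the singularities makes \<open>L\<^sup>*(b / \<Delta>\<^bsup>e+1\<^esup>)\<close> cancel the poles of
  order \<open>e+1+n\<close>. The degree at infinity may grow, which is why it is treated after the finite poles.\<close>

lemma high_pole_in_Q: "a \<in> P \<Longrightarrow> \<Phi> a (e + n) 0 \<in> Q"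
proof (induction e arbitrary: a)
  case 0
  thus ?case using pole_order_n_in_Q by simp
next
  case (Suc e)
  have adj: "poly (adj (Suc e) b) t = poly (adj (Suc e) 1) t * poly b t" if "t \<in> S" for b t
    using that by (simp add: adj_at_singularity)
  obtain b where b: "b \<in> P" "\<And>t. t \<in> S \<Longrightarrow> poly (adj (Suc e) 1) t * poly b t = poly a t"
    by (rule residue_interpolation[OF adj_P[OF P_1, of "Suc e"] Suc.prems]) (rule adj_1_nz, assumption, simp, rule that)
  let ?B = "adj (Suc e) b"
  obtain a' where a': "a' \<in> P" "a - ?B = \<Delta> * a'"
  proof (rule divide_by_Delta)
    show "a - ?B \<in> P" by (rule P_diff[OF Suc.prems adj_P[OF b(1)]])
    show "poly (a - ?B) t = 0" if "t \<in> S" for t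
      using adj[OF that, of b] b(2)[OF that] by simp
  qed (rule that)
  have "\<Phi> (a - ?B) (Suc e + n) 0 = \<Phi> a' (e + n) 0"
    by (simp add: a'(2) \<Phi>_Delta_cancel)
  with Suc.IH[OF a'(1)] have "\<Phi> (a - ?B) (Suc e + n) 0 \<in> Q" by simp
  with adj_in_Q[OF b(1), of "Suc e"] show ?case by (rule \<Phi>_split)
qed

lemma \<Phi>_in_Q:
  assumes "a \<in> P" "i < n"
  shows "\<Phi> a e i \<in> Q"
proof -
  let ?A = "dnums \<Delta> e i a"
  \<comment> \<open>Expanding the fraction by \<open>\<Delta>\<^sup>n\<close> makes the formal pole order at least \<open>n\<close>.\<close>
  have "\<Phi> (\<Delta> ^ n * ?A) (e + i + n) 0 \<in> Q"
    by (intro high_pole_in_Q P_mult P_power Delta_P dnums_P assms)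
  hence "\<Phi> ?A (e + i) 0 \<in> Q" by (simp only: \<Phi>_cancel)
  hence "(\<lambda>x. (\<Phi> a e i x - (- 1) ^ i * \<Phi> ?A (e + i) 0 x) + (- 1) ^ i * \<Phi> ?A (e + i) 0 x) \<in> Q"
    using assms by (intro Q_add integrate_by_parts Q_smult[OF sign_mem]) auto
  thus ?thesis by simp
qed

end

section \<open>Generators of a quotient module\<close>

lemma (in module) submodule_mspan:
  assumes "A \<subseteq> carrier M"
  shows "submodule (mspan R M A) R M"
proof -
  let ?\<H> = "{H. submodule H R M \<and> A \<subseteq> H}"
  have carr: "carrier M \<in> ?\<H>" using carrier_is_submodule assms by auto
  note E = submoduleE
  show ?thesis unfolding mspan_def hull_def
  proof (rule submoduleI)
    show "\<Inter> ?\<H> \<subseteq> carrier M" using carr by blast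
    show "\<zero>\<^bsub>M\<^esub> \<in> \<Inter> ?\<H>"
      by (auto dest!: submodule.axioms(1) subgroup.one_closed)
  qed (auto dest: E(3,4,5))
qed

lemma mspan_minimal: "submodule H R M \<Longrightarrow> A \<subseteq> H \<Longrightarrow> mspan R M A \<subseteq> H"
  unfolding mspan_def by (rule hull_minimal)

lemma mspan_superset: "A \<subseteq> mspan R M A"
  unfolding mspan_def by (rule hull_subset)

text \<open>For a submodule \<open>H\<close> of the quotient that contains the classes of \<open>G\<close>, the elements of \<open>T\<close> with class
  in \<open>H\<close> form a submodule containing \<open>D\<close> and \<open>G\<close>, hence everything. The other inclusion is not void:
  a span is an intersection of submodules, so the quotient has to be shown to be one.\<close>

lemma (in module) carrier_quot_module_eq_mspan:
  assumes D: "submodule D R M" and T: "submodule T R M"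
    and DT: "D \<subseteq> T" and GT: "G \<subseteq> T" and span: "T \<subseteq> mspan R M (D \<union> G)"
  shows "carrier (quot_module (M\<lparr>carrier := T\<rparr>) D) =
    mspan R (quot_module (M\<lparr>carrier := T\<rparr>) D) {D +>\<^bsub>M\<^esub> g | g. g \<in> G}"
proof -
  let ?N = "M\<lparr>carrier := T\<rparr>"
  let ?Q = "quot_module ?N D"
  interpret N: module R ?N by (rule submodule.submodule_is_module[OF T module_axioms])
  note Dcl = submoduleE[OF D] and Tcl = submoduleE[OF T]
  have D0: "\<zero>\<^bsub>M\<^esub> \<in> D" using D by (auto dest!: submodule.axioms(1) subgroup.one_closed)
  have T0: "\<zero>\<^bsub>M\<^esub> \<in> T" using D0 DT by blast
  have coset: "D +>\<^bsub>?N\<^esub> t = D +>\<^bsub>M\<^esub> t" for t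
    by (simp add: a_r_coset_def')
  have DN: "submodule D R ?N"
  proof (rule N.submoduleI)
    fix a assume a: "a \<in> D"
    have "\<ominus>\<^bsub>?N\<^esub> a = (\<ominus> \<one>) \<odot>\<^bsub>M\<^esub> a"
      using N.smult_l_minus[of \<one> a] smult_one[of a] a DT Dcl(1) by (simp add: subset_iff)
    thus "\<ominus>\<^bsub>?N\<^esub> a \<in> D" using a by (simp add: Dcl(4))
  qed (use DT D0 Dcl in auto)
  interpret D: abelian_subgroup D ?N
    by (rule abelian_subgroupI2)
      (use N.a_comm_group submodule.axioms(1)[OF DN] in auto)
  have carr: "carrier ?Q = {D +>\<^bsub>M\<^esub> t | t. t \<in> T}"
    by (auto simp: quot_module_def A_RCOSETS_def' coset)
  have add: "(D +>\<^bsub>M\<^esub> s) \<oplus>\<^bsub>?Q\<^esub> (D +>\<^bsub>M\<^esub> t) = D +>\<^bsub>M\<^esub> (s \<oplus>\<^bsub>M\<^esub> t)" if "s \<in> T" "t \<in> T" for s t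
    using D.a_rcos_sum[of s t] that by (simp add: quot_module_def coset)
  have smult: "a \<odot>\<^bsub>?Q\<^esub> (D +>\<^bsub>M\<^esub> t) = D +>\<^bsub>M\<^esub> (a \<odot>\<^bsub>M\<^esub> t)" if a: "a \<in> carrier R" and t: "t \<in> T" for a t
  proof -
    have Dc: "d \<in> D \<Longrightarrow> d \<in> carrier M" for d using Dcl(1) by blast
    have tc: "t \<in> carrier M" using t Tcl(1) by blast
    have "a \<odot>\<^bsub>?Q\<^esub> (D +>\<^bsub>M\<^esub> t) = {d \<oplus>\<^bsub>M\<^esub> a \<odot>\<^bsub>M\<^esub> (d' \<oplus>\<^bsub>M\<^esub> t) | d d'. d \<in> D \<and> d' \<in> D}"
      by (auto simp: quot_module_def set_add_def' a_r_coset_def')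
    also have "\<dots> = D +>\<^bsub>M\<^esub> (a \<odot>\<^bsub>M\<^esub> t)"
    proof (intro equalityI subsetI)
      fix y assume "y \<in> {d \<oplus>\<^bsub>M\<^esub> a \<odot>\<^bsub>M\<^esub> (d' \<oplus>\<^bsub>M\<^esub> t) | d d'. d \<in> D \<and> d' \<in> D}"
      then obtain d d' where y: "y = d \<oplus>\<^bsub>M\<^esub> a \<odot>\<^bsub>M\<^esub> (d' \<oplus>\<^bsub>M\<^esub> t)" "d \<in> D" "d' \<in> D" by blast
      hence "y = (d \<oplus>\<^bsub>M\<^esub> a \<odot>\<^bsub>M\<^esub> d') \<oplus>\<^bsub>M\<^esub> a \<odot>\<^bsub>M\<^esub> t"
        using a tc Dc by (simp add: smult_r_distr a_assoc)
      moreover have "d \<oplus>\<^bsub>M\<^esub> a \<odot>\<^bsub>M\<^esub> d' \<in> D" using y a Dcl by auto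
      ultimately show "y \<in> D +>\<^bsub>M\<^esub> (a \<odot>\<^bsub>M\<^esub> t)" by (auto simp: a_r_coset_def')
    next
      fix y assume "y \<in> D +>\<^bsub>M\<^esub> (a \<odot>\<^bsub>M\<^esub> t)"
      then obtain d where d: "d \<in> D" "y = d \<oplus>\<^bsub>M\<^esub> a \<odot>\<^bsub>M\<^esub> t" by (auto simp: a_r_coset_def')
      hence "y = d \<oplus>\<^bsub>M\<^esub> a \<odot>\<^bsub>M\<^esub> (\<zero>\<^bsub>M\<^esub> \<oplus>\<^bsub>M\<^esub> t)" using tc by simp
      thus "y \<in> {d \<oplus>\<^bsub>M\<^esub> a \<odot>\<^bsub>M\<^esub> (d' \<oplus>\<^bsub>M\<^esub> t) | d d'. d \<in> D \<and> d' \<in> D}"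
        using d(1) D0 by blast
    qed
    finally show ?thesis .
  qed
  have QC: "submodule (carrier ?Q) R ?Q"
  proof (intro submodule.intro submodule_axioms.intro)
    have "group (add_monoid ?Q)"
      using D.a_factorgroup_is_group
      by (simp add: group_def group_axioms_def monoid_def Units_def quot_module_def A_FactGroup_def')
    from group.subgroup_self[OF this] show "subgroup (carrier ?Q) (add_monoid ?Q)" by simp
    show "a \<odot>\<^bsub>?Q\<^esub> x \<in> carrier ?Q" if "a \<in> carrier R" "x \<in> carrier ?Q" for a x
      using that smult Tcl(4) unfolding carr by auto
  qed
  show ?thesis
  proof
    show "mspan R ?Q {D +>\<^bsub>M\<^esub> g | g. g \<in> G} \<subseteq> carrier ?Q"
      by (rule mspan_minimal[OF QC]) (use GT in \<open>auto simp: carr\<close>)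
    show "carrier ?Q \<subseteq> mspan R ?Q {D +>\<^bsub>M\<^esub> g | g. g \<in> G}"
      unfolding mspan_def hull_def
    proof (rule Inter_greatest)
      fix H assume "H \<in> {H. submodule H R ?Q \<and> {D +>\<^bsub>M\<^esub> g | g. g \<in> G} \<subseteq> H}"
      hence H: "submodule H R ?Q" and GH: "\<And>g. g \<in> G \<Longrightarrow> D +>\<^bsub>M\<^esub> g \<in> H" by auto
      have H0: "D \<in> H"
        using subgroup.one_closed[OF submodule.axioms(1)[OF H]] by (simp add: quot_module_def)
      have Hadd: "x \<oplus>\<^bsub>?Q\<^esub> y \<in> H" if "x \<in> H" "y \<in> H" for x y
        using subgroup.m_closed[OF submodule.axioms(1)[OF H], of x y] that by simp
      have DH: "D +>\<^bsub>M\<^esub> d \<in> H" if "d \<in> D" for d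
        using D.a_rcos_const[OF that] H0 coset by simp
      have "submodule {t \<in> T. D +>\<^bsub>M\<^esub> t \<in> H} R M"
      proof (rule submoduleI)
        show "{t \<in> T. D +>\<^bsub>M\<^esub> t \<in> H} \<subseteq> carrier M" using Tcl(1) by blast
        show "\<zero>\<^bsub>M\<^esub> \<in> {t \<in> T. D +>\<^bsub>M\<^esub> t \<in> H}" using T0 DH[OF D0] by simp
        show sm: "a \<odot>\<^bsub>M\<^esub> x \<in> {t \<in> T. D +>\<^bsub>M\<^esub> t \<in> H}"
          if "a \<in> carrier R" "x \<in> {t \<in> T. D +>\<^bsub>M\<^esub> t \<in> H}" for a x
          using that smult[of a x] submodule.smult_closed[OF H, of a "D +>\<^bsub>M\<^esub> x"] Tcl(4) by auto
        show "x \<oplus>\<^bsub>M\<^esub> y \<in> {t \<in> T. D +>\<^bsub>M\<^esub> t \<in> H}"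
          if "x \<in> {t \<in> T. D +>\<^bsub>M\<^esub> t \<in> H}" "y \<in> {t \<in> T. D +>\<^bsub>M\<^esub> t \<in> H}" for x y
          using that add[of x y] Hadd[of "D +>\<^bsub>M\<^esub> x" "D +>\<^bsub>M\<^esub> y"] Tcl(5) by auto
        show "\<ominus>\<^bsub>M\<^esub> x \<in> {t \<in> T. D +>\<^bsub>M\<^esub> t \<in> H}" if "x \<in> {t \<in> T. D +>\<^bsub>M\<^esub> t \<in> H}" for x
        proof -
          have "x \<in> carrier M" using that Tcl(1) by blast
          hence "\<ominus>\<^bsub>M\<^esub> x = (\<ominus> \<one>) \<odot>\<^bsub>M\<^esub> x" using smult_l_minus[of \<one> x] by simp
          thus ?thesis using sm[OF _ that] by simp
        qed
      qed
      hence "mspan R M (D \<union> G) \<subseteq> {t \<in> T. D +>\<^bsub>M\<^esub> t \<in> H}"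
        by (rule mspan_minimal) (use DT GT DH GH in auto)
      with span show "carrier ?Q \<subseteq> H" unfolding carr by auto
    qed
  qed
qed


section \<open>The de Rham cohomology group\<close>

lemma module_holo_forms:
  assumes "subfield k complex_ring"
  shows "module (scalars k) (holo_forms U)"
proof -
  interpret C: field complex_ring by (rule field_from_type_algebra)
  have "field (scalars k)" using C.subfield_iff(2)[OF assms] .
  hence cring: "cring (scalars k)" by (simp add: field_def domain_def)
  have group: "abelian_group (holo_forms U)"
  proof (rule abelian_groupI)
    show "x \<oplus>\<^bsub>holo_forms U\<^esub> y \<in> carrier (holo_forms U)"
      if xy: "x \<in> carrier (holo_forms U)" "y \<in> carrier (holo_forms U)" for x y
    proof -
      from xy obtain g h where "x = form_on U g" "g holomorphic_on U" "y = form_on U h" "h holomorphic_on U"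
        by (auto simp: holo_forms_def)
      thus ?thesis unfolding holo_forms_def
        by (auto intro!: exI[of _ "\<lambda>z. g z + h z"] holomorphic_intros simp: form_on_def)
    qed
    show "\<exists>y\<in>carrier (holo_forms U). y \<oplus>\<^bsub>holo_forms U\<^esub> x = \<zero>\<^bsub>holo_forms U\<^esub>"
      if x: "x \<in> carrier (holo_forms U)" for x
    proof -
      from x obtain g where g: "x = form_on U g" "g holomorphic_on U" by (auto simp: holo_forms_def)
      show ?thesis
      proof (rule bexI[of _ "form_on U (\<lambda>z. - g z)"])
        show "form_on U (\<lambda>z. - g z) \<in> carrier (holo_forms U)"
          using g by (auto simp: holo_forms_def intro!: holomorphic_intros)
      qed (auto simp: holo_forms_def g form_on_def)
    qed
    show "\<zero>\<^bsub>holo_forms U\<^esub> \<in> carrier (holo_forms U)"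
      by (auto simp: holo_forms_def form_on_def intro!: exI[of _ "\<lambda>_. 0"])
  qed (auto simp: holo_forms_def add_ac)
  show ?thesis
  proof (rule moduleI[OF cring group])
    show "a \<odot>\<^bsub>holo_forms U\<^esub> x \<in> carrier (holo_forms U)"
      if "x \<in> carrier (holo_forms U)" for a x
    proof -
      from that obtain g where "x = form_on U g" "g holomorphic_on U" by (auto simp: holo_forms_def)
      thus ?thesis unfolding holo_forms_def
        by (auto intro!: exI[of _ "\<lambda>z. a * g z"] holomorphic_intros simp: form_on_def)
    qed
  qed (auto simp: holo_forms_def ring_of_type_algebra_def algebra_simps)
qed

context fuchsian_solution
begin

interpretation F: module "scalars k" "holo_forms U"
  by (rule module_holo_forms[OF subfield_k])

lemma submodule_holo_formsD:
  assumes "submodule H (scalars k) (holo_forms U)"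
  shows "(\<lambda>x. 0) \<in> H" "g \<in> H \<Longrightarrow> h \<in> H \<Longrightarrow> (\<lambda>x. g x + h x) \<in> H"
    "s \<in> k \<Longrightarrow> g \<in> H \<Longrightarrow> (\<lambda>x. s * g x) \<in> H"
  using subgroup.one_closed[OF submodule.axioms(1)[OF assms]]
    F.submoduleE(4,5)[OF assms] by (simp_all add: holo_forms_def)

abbreviation T :: "(complex \<Rightarrow> complex) set" where "T \<equiv> twisted_forms k n p f U"
abbreviation E :: "(complex \<Rightarrow> complex) set" where "E \<equiv> exact_forms k n p f U"

lemma twisted_eq: "T = mspan (scalars k) (holo_forms U) {\<Phi> a e i | a e i. a \<in> P \<and> i < n}"
proof -
  have "{form_on U (\<lambda>x. ratfun_eval q x * (deriv ^^ i) f x) | q i.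
        q \<in> ratfuns_over k \<and> finite_poles q \<subseteq> S \<and> i < n} = {\<Phi> a e i | a e i. a \<in> P \<and> i < n}"
  proof (intro equalityI subsetI)
    fix y assume "y \<in> {form_on U (\<lambda>x. ratfun_eval q x * (deriv ^^ i) f x) | q i.
        q \<in> ratfuns_over k \<and> finite_poles q \<subseteq> S \<and> i < n}"
    then obtain q i where q: "q \<in> ratfuns_over k" "finite_poles q \<subseteq> S" "i < n"
      "y = form_on U (\<lambda>x. ratfun_eval q x * (deriv ^^ i) f x)" by blast
    obtain a e where a: "a \<in> P" "\<And>x. x \<notin> S \<Longrightarrow> ratfun_eval q x = poly a x / poly \<Delta> x ^ e"
      by (rule ratfun_as_Delta_fraction[OF q(1,2)]) (rule that)
    have "y = \<Phi> a e i" unfolding q(4) by (rule ratfun_form[OF a(2)])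
    with a(1) q(3) show "y \<in> {\<Phi> a e i | a e i. a \<in> P \<and> i < n}" by blast
  next
    fix y assume "y \<in> {\<Phi> a e i | a e i. a \<in> P \<and> i < n}"
    then obtain a e i where a: "a \<in> P" "i < n" "y = \<Phi> a e i" by blast
    obtain q where q: "q \<in> ratfuns_over k" "finite_poles q \<subseteq> S"
      "\<And>x. x \<notin> S \<Longrightarrow> ratfun_eval q x = poly a x / poly \<Delta> x ^ e"
      by (rule Delta_fraction_as_ratfun[OF a(1)]) (rule that)
    have "y = form_on U (\<lambda>x. ratfun_eval q x * (deriv ^^ i) f x)"
      unfolding a(3) by (rule ratfun_form[OF q(3), symmetric])
    with a(2) q(1,2) show "y \<in> {form_on U (\<lambda>x. ratfun_eval q x * (deriv ^^ i) f x) | q i.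
        q \<in> ratfuns_over k \<and> finite_poles q \<subseteq> S \<and> i < n}" by blast
  qed
  thus ?thesis unfolding twisted_forms_def by simp
qed

lemma submodule_twisted: "submodule T (scalars k) (holo_forms U)"
  unfolding twisted_eq by (rule F.submodule_mspan) (use \<Phi>_carrier in auto)

lemma \<Phi>_twisted: "a \<in> P \<Longrightarrow> i < n \<Longrightarrow> \<Phi> a e i \<in> T"
  unfolding twisted_eq by (rule subsetD[OF mspan_superset]) blast

text \<open>The derivative of \<open>q f\<^bsup>(n-1)\<^esup>\<close> involves \<open>f\<^bsup>(n)\<^esup>\<close>, which the equation expresses by lower derivatives
  with coefficients that have poles only in \<open>S\<close>. This is why exact forms are among the twisted forms.\<close>

lemma \<Phi>_n_twisted:
  assumes "a \<in> P"
  shows "\<Phi> a e n \<in> T"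
proof -
  note T = submodule_holo_formsD[OF submodule_twisted]
  have Tsum: "(\<lambda>x. \<Sum>i\<in>A. g i x) \<in> T" if "\<And>i. i \<in> A \<Longrightarrow> g i \<in> T" for g and A :: "nat set"
    using that by (induction A rule: infinite_finite_induct) (auto intro: T)
  have "(\<lambda>x. - 1 * (\<Sum>i\<in>{1..n}. \<Phi> (c i * a) (e + i) (n - i) x)) \<in> T"
    by (intro T(3) Tsum uminus_mem one_mem \<Phi>_twisted P_mult c_P assms) auto
  also have "(\<lambda>x. - 1 * (\<Sum>i\<in>{1..n}. \<Phi> (c i * a) (e + i) (n - i) x)) = \<Phi> a e n"
  proof
    fix x
    have "{..n} = insert 0 {1..n}" by auto
    hence "\<Phi> a e n x + (\<Sum>i\<in>{1..n}. \<Phi> (c i * a) (e + i) (n - i) x) = 0"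
      using \<Phi>_equation[of a e x] by (simp add: c_0)
    thus "- 1 * (\<Sum>i\<in>{1..n}. \<Phi> (c i * a) (e + i) (n - i) x) = \<Phi> a e n x"
      by (simp add: neg_eq_iff_add_eq_0 add.commute)
  qed
  finally show ?thesis .
qed

lemma exact_gens_twisted:
  "{form_on U (deriv (\<lambda>x. ratfun_eval q x * (deriv ^^ i) f x)) | q i.
        q \<in> ratfuns_over k \<and> finite_poles q \<subseteq> S \<and> i < n} \<subseteq> T"
proof
  fix y assume "y \<in> {form_on U (deriv (\<lambda>x. ratfun_eval q x * (deriv ^^ i) f x)) | q i.
        q \<in> ratfuns_over k \<and> finite_poles q \<subseteq> S \<and> i < n}"
  then obtain q i where q: "q \<in> ratfuns_over k" "finite_poles q \<subseteq> S" "i < n"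
    "y = form_on U (deriv (\<lambda>x. ratfun_eval q x * (deriv ^^ i) f x))" by blast
  obtain a e where a: "a \<in> P" "\<And>x. x \<notin> S \<Longrightarrow> ratfun_eval q x = poly a x / poly \<Delta> x ^ e"
    by (rule ratfun_as_Delta_fraction[OF q(1,2)]) (rule that)
  have "\<Phi> a e (Suc i) \<in> T"
    using \<Phi>_twisted[OF a(1), of "Suc i"] \<Phi>_n_twisted[OF a(1)] q(3) by (cases "Suc i = n") auto
  moreover have "y = (\<lambda>x. \<Phi> (dnum \<Delta> e a) (Suc e) i x + \<Phi> a e (Suc i) x)"
    unfolding q(4) by (rule ratfun_form_deriv[OF a(2)])
  ultimately show "y \<in> T"
    using submodule_holo_formsD(2)[OF submodule_twisted \<Phi>_twisted[OF dnum_P[OF a(1)] q(3)]] by simp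
qed

lemma exact_subset_twisted: "E \<subseteq> T"
  unfolding exact_forms_def by (rule mspan_minimal[OF submodule_twisted exact_gens_twisted])

lemma submodule_exact: "submodule E (scalars k) (holo_forms U)"
  unfolding exact_forms_def
  by (rule F.submodule_mspan) (use exact_gens_twisted F.submoduleE(1)[OF submodule_twisted] in blast)

lemma \<Phi>_exact:
  assumes "a \<in> P" "i < n"
  shows "(\<lambda>x. \<Phi> (dnum \<Delta> e a) (Suc e) i x + \<Phi> a e (Suc i) x) \<in> E"
proof -
  obtain q where q: "q \<in> ratfuns_over k" "finite_poles q \<subseteq> S"
    "\<And>x. x \<notin> S \<Longrightarrow> ratfun_eval q x = poly a x / poly \<Delta> x ^ e"
    by (rule Delta_fraction_as_ratfun[OF assms(1)]) (rule that)
  have "(\<lambda>x. \<Phi> (dnum \<Delta> e a) (Suc e) i x + \<Phi> a e (Suc i) x) =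
      form_on U (deriv (\<lambda>x. ratfun_eval q x * (deriv ^^ i) f x))"
    by (rule ratfun_form_deriv[OF q(3), symmetric])
  thus ?thesis
    unfolding exact_forms_def
    by (intro subsetD[OF mspan_superset]) (use q(1,2) assms(2) in blast)
qed

end

theorem theorem2:
  fixes k :: "complex set" and n :: nat and p :: "nat \<Rightarrow> complex poly"
    and U :: "complex set" and f :: "complex \<Rightarrow> complex"
  assumes "subfield k complex_ring"
    and "n \<ge> 1"
    and "\<forall>i\<le>n. p i \<in> polys_over k"
    and "p 0 \<noteq> 0"
    and "fuchsian n p"
    and "open U" and "U \<noteq> {}" and "simply_connected U" and "U \<inter> finite_sings n p = {}"
    and "f holomorphic_on U"
    and "\<forall>x\<in>U. diffop n p f x = 0"
    and "\<forall>t. \<forall>m::int. m \<ge> int n \<longrightarrow> of_int m \<notin> exponents n p t"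
    and "\<forall>m::int. m > 0 \<longrightarrow> of_int m \<notin> exponents_inf n p"
  shows "carrier (H1dR k n p f U) =
    mspan (scalars k) (H1dR k n p f U)
      {form_class k n p f U
         (form_on U (\<lambda>x. x ^ j * (deriv ^^ i) f x / poly (Delta n p) x)) | j i.
         j < card (finite_sings n p) \<and> i < n}"
proof -
  interpret fuchsian_solution k n p U f
    by (intro fuchsian_solution.intro fuchsian_operator.intro complex_subfield.intro
        fuchsian_operator_axioms.intro fuchsian_solution_axioms.intro) (use assms in auto)
  interpret exponent_conditions k n p
    by (intro exponent_conditions.intro fuchsian_operator_axioms exponent_conditions_axioms.intro)
      (use assms in auto)
  interpret F: module "scalars k" "holo_forms U"
    by (rule module_holo_forms[OF assms(1)])
  let ?G = "{\<Phi> (Polynomial.monom 1 j) 1 i | j i. j < r \<and> i < n}"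
  have GT: "?G \<subseteq> T" using \<Phi>_twisted P_monom[OF one_mem] by blast
  \<comment> \<open>Once this span contains all twisted forms, the classes of \<open>?G\<close> generate the quotient by \<open>E\<close>.\<close>
  let ?Q = "mspan (scalars k) (holo_forms U) (E \<union> ?G)"
  have Qsub: "submodule ?Q (scalars k) (holo_forms U)"
    by (rule F.submodule_mspan)
      (use GT exact_subset_twisted F.submoduleE(1)[OF submodule_twisted] in blast)
  interpret R: de_rham_reduction k n p U f ?Q
  proof unfold_locales
    show "a \<in> P \<Longrightarrow> i < n \<Longrightarrow> (\<lambda>x. \<Phi> (dnum \<Delta> e a) (Suc e) i x + \<Phi> a e (Suc i) x) \<in> ?Q" for a i e
      using \<Phi>_exact mspan_superset[of "E \<union> ?G"] by blast
    show "j < r \<Longrightarrow> i < n \<Longrightarrow> \<Phi> (Polynomial.monom 1 j) 1 i \<in> ?Q" for j i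
      using mspan_superset[of "E \<union> ?G"] by blast
  qed (use submodule_holo_formsD[OF Qsub] in auto)
  have span: "T \<subseteq> ?Q"
    unfolding twisted_eq by (rule mspan_minimal[OF Qsub]) (use R.\<Phi>_in_Q in blast)
  have gen: "form_on U (\<lambda>x. x ^ j * (deriv ^^ i) f x / poly \<Delta> x) = \<Phi> (Polynomial.monom 1 j) 1 i" for j i
    by (rule ext) (simp add: \<Phi>_apply form_on_def poly_monom)
  have "{form_class k n p f U (form_on U (\<lambda>x. x ^ j * (deriv ^^ i) f x / poly \<Delta> x)) | j i. j < r \<and> i < n}
      = {E +>\<^bsub>holo_forms U\<^esub> g | g. g \<in> ?G}"
    unfolding form_class_def gen by blast
  thus ?thesis
    unfolding H1dR_def
    using F.carrier_quot_module_eq_mspan[OF submodule_exact submodule_twisted exact_subset_twisted GT span]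
    by simp
qed

end
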